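(* Let $R$ be a ring, let $\pi : R\to R/\mathfrak{l}^s_R$, $r\mapsto r+\mathfrak{l}^s_R$, let $\sigma : R\to Q_l^s(R)$, $r\mapsto \frac{r}{1}$, and let $Q_l^s(R)^*$ be the group of units of the ring $Q_l^s(R)$. Then 1. $T_l(R)=S_{l,\mathfrak{l}^s_R}(R)$. 2. $Q_l^s(R)=Q_{l,\mathfrak{l}^s_R}(R)\simeq Q_l(R/\mathfrak{l}^s_R)$. 3. $T_l(R)=\sigma^{-1}(Q_l^s(R)^* )$. 4. $T_l(R)=\pi^{-1}(S_{l,0}(R/\mathfrak{l}^s_R))$. 5. $Q_l^s(R)^*=\{s^{-1}t \mid s,t\in T_l(R)\}$.
   Context: Rings are associative with $1$ and nonzero. A multiplicative subset $S$ of $R$ is a submonoid of $(R,\cdot)$ with $1\in S$, $0\notin S$. It is a left Ore set if $Sr\cap Rs\neq\emptyset$ for all $r\in R$, $s\in S$; then $\mathrm{ass}(S):=\{r\in R\mid sr=0 \text{ for some } s\in S\}$ is an ideal. A left Ore set $S$ is a left denominator set if $rs=0$ with $r\in R$, $s\in S$ implies $r\in\mathrm{ass}(S)$. $\mathrm{Den}_l(R)$ is the set of left denominator sets of $R$; for $S\in\mathrm{Den}_l(R)$, $S^{-1}R=\{s^{-1}r\mid s\in S,r\in R\}$ is the left localization. $\mathrm{max.Den}_l(R)$ is the (non-empty) set of elements of $\mathrm{Den}_l(R)$ maximal under inclusion. $\mathcal{L}^s_l(R):=\bigcap_{S\in \mathrm{max.Den}_l(R)}S$. $T_l(R)$ is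 the union of all $S\in\mathrm{Den}_l(R)$ with $S\subseteq\mathcal{L}^s_l(R)$; it is the largest left denominator set of $R$ contained in $\mathcal{L}^s_l(R)$. $Q_l^s(R):=T_l(R)^{-1}R$ and $\mathfrak{l}^s_R:=\mathrm{ass}(T_l(R))$. For an ideal $\mathfrak{a}$ of $R$ that equals $\mathrm{ass}(S)$ for some $S\in\mathrm{Den}_l(R)$, $S_{l,\mathfrak{a}}(R)$ is the largest (under inclusion) left denominator set $S$ of $R$ with $\mathrm{ass}(S)=\mathfrak{a}$ (it exists), and $Q_{l,\mathfrak{a}}(R):=S_{l,\mathfrak{a}}(R)^{-1}R$. In particular $S_{l,0}(R)$ is the largest left denominator set with $\mathrm{ass}=0$ (equivalently, the largest left Ore set consisting of non-zero-divisors), and $Q_l(R):=S_{l,0}(R)^{-1}R$. *)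

theory Defs
  imports "HOL-Algebra.QuotRing"
begin

definition multiplicative_subset :: "('a, 'm) ring_scheme \<Rightarrow> 'a set \<Rightarrow> bool" where
  "multiplicative_subset R S \<longleftrightarrow> submonoid S R \<and> \<zero>\<^bsub>R\<^esub> \<notin> S"

text \<open>\<open>S #> r\<close> is the set \<open>S r\<close>, and \<open>carrier R #> s\<close> is \<open>R s\<close>.\<close>

definition left_Ore_set :: "('a, 'm) ring_scheme \<Rightarrow> 'a set \<Rightarrow> bool" where
  "left_Ore_set R S \<longleftrightarrow> multiplicative_subset R S \<and>
     (\<forall>r\<in>carrier R. \<forall>s\<in>S. (S #>\<^bsub>R\<^esub> r) \<inter> (carrier R #>\<^bsub>R\<^esub> s) \<noteq> {})"

definition ass :: "('a, 'm) ring_scheme \<Rightarrow> 'a set \<Rightarrow> 'a set" where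
  "ass R S = {r \<in> carrier R. \<exists>s\<in>S. s \<otimes>\<^bsub>R\<^esub> r = \<zero>\<^bsub>R\<^esub>}"

definition Den_l :: "('a, 'm) ring_scheme \<Rightarrow> 'a set set" where
  "Den_l R = {S. left_Ore_set R S \<and>
     (\<forall>r\<in>carrier R. \<forall>s\<in>S. r \<otimes>\<^bsub>R\<^esub> s = \<zero>\<^bsub>R\<^esub> \<longrightarrow> r \<in> ass R S)}"

text \<open>
  The left localization \<open>S\<^sup>-\<^sup>1R\<close> of \<open>R\<close> at a left denominator set \<open>S\<close>, as classes of
  pairs \<open>(s, r)\<close> standing for \<open>s\<^sup>-\<^sup>1r\<close>.  Two fractions agree iff they can be expanded from
  the left to a common denominator in \<open>S\<close> with equal numerators; the expanding
  factors \<open>a\<close>, \<open>b\<close> themselves need not lie in \<open>S\<close>.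
\<close>

definition left_frac_rel :: "('a, 'm) ring_scheme \<Rightarrow> 'a set \<Rightarrow> (('a \<times> 'a) \<times> ('a \<times> 'a)) set" where
  "left_frac_rel R S = {((s, r), (t, q)). s \<in> S \<and> r \<in> carrier R \<and> t \<in> S \<and> q \<in> carrier R \<and>
     (\<exists>a\<in>carrier R. \<exists>b\<in>carrier R. a \<otimes>\<^bsub>R\<^esub> s = b \<otimes>\<^bsub>R\<^esub> t \<and> a \<otimes>\<^bsub>R\<^esub> s \<in> S \<and>
        a \<otimes>\<^bsub>R\<^esub> r = b \<otimes>\<^bsub>R\<^esub> q)}"

definition left_frac :: "('a, 'm) ring_scheme \<Rightarrow> 'a set \<Rightarrow> 'a \<Rightarrow> 'a \<Rightarrow> ('a \<times> 'a) set" where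
  "left_frac R S s r = left_frac_rel R S `` {(s, r)}"

text \<open>
  Operations on classes are unions over all representatives and all admissible
  auxiliary factors.  The formulas are
  \<open>s\<^sup>-\<^sup>1r + t\<^sup>-\<^sup>1q = (as)\<^sup>-\<^sup>1(ar + bq)\<close> where \<open>as = bt \<in> S\<close>, and
  \<open>s\<^sup>-\<^sup>1r \<cdot> t\<^sup>-\<^sup>1q = (as)\<^sup>-\<^sup>1(bq)\<close> where \<open>a \<in> S\<close> and \<open>ar = bt\<close>.
  For \<open>S\<close> a left denominator set the resulting fraction does not depend on the choices,
  so each union is again a single class.
\<close>

definition left_frac_add ::
  "('a, 'm) ring_scheme \<Rightarrow> 'a set \<Rightarrow> ('a \<times> 'a) set \<Rightarrow> ('a \<times> 'a) set \<Rightarrow> ('a \<times> 'a) set" where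
  "left_frac_add R S x y = {z. \<exists>s r t q a b.
     (s, r) \<in> x \<and> (t, q) \<in> y \<and> a \<in> carrier R \<and> b \<in> carrier R \<and> a \<otimes>\<^bsub>R\<^esub> s = b \<otimes>\<^bsub>R\<^esub> t \<and> a \<otimes>\<^bsub>R\<^esub> s \<in> S \<and>
     z \<in> left_frac R S (a \<otimes>\<^bsub>R\<^esub> s) (a \<otimes>\<^bsub>R\<^esub> r \<oplus>\<^bsub>R\<^esub> b \<otimes>\<^bsub>R\<^esub> q)}"

definition left_frac_mult ::
  "('a, 'm) ring_scheme \<Rightarrow> 'a set \<Rightarrow> ('a \<times> 'a) set \<Rightarrow> ('a \<times> 'a) set \<Rightarrow> ('a \<times> 'a) set" where
  "left_frac_mult R S x y = {z. \<exists>s r t q a b.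
     (s, r) \<in> x \<and> (t, q) \<in> y \<and> a \<in> S \<and> b \<in> carrier R \<and> a \<otimes>\<^bsub>R\<^esub> r = b \<otimes>\<^bsub>R\<^esub> t \<and>
     z \<in> left_frac R S (a \<otimes>\<^bsub>R\<^esub> s) (b \<otimes>\<^bsub>R\<^esub> q)}"

definition left_localization :: "('a, 'm) ring_scheme \<Rightarrow> 'a set \<Rightarrow> ('a \<times> 'a) set ring" where
  "left_localization R S =
     \<lparr>carrier = {left_frac R S s r | s r. s \<in> S \<and> r \<in> carrier R},
      mult = left_frac_mult R S,
      one = left_frac R S \<one>\<^bsub>R\<^esub> \<one>\<^bsub>R\<^esub>,
      zero = left_frac R S \<one>\<^bsub>R\<^esub> \<zero>\<^bsub>R\<^esub>,
      add = left_frac_add R S\<rparr>"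

definition max_Den_l :: "('a, 'm) ring_scheme \<Rightarrow> 'a set set" where
  "max_Den_l R = {S \<in> Den_l R. \<forall>S'\<in>Den_l R. S \<subseteq> S' \<longrightarrow> S' = S}"

text \<open>
  \<open>strong_L\<close>, \<open>strong_Q_l\<close>, \<open>strong_ideal\<close> are the objects with superscript \<open>s\<close>:
  the set \<open>\<L>\<^sub>l\<^sup>s(R)\<close>, the ring \<open>Q\<^sub>l\<^sup>s(R)\<close> and the ideal \<open>\<ll>\<^sub>R\<^sup>s\<close>.
  The intersection below is over a nonempty family whenever \<open>R\<close> is a nonzero ring.
\<close>

definition strong_L :: "('a, 'm) ring_scheme \<Rightarrow> 'a set" where
  "strong_L R = \<Inter>(max_Den_l R)"

definition T_l :: "('a, 'm) ring_scheme \<Rightarrow> 'a set" where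
  "T_l R = \<Union>{S \<in> Den_l R. S \<subseteq> strong_L R}"

definition strong_Q_l :: "('a, 'm) ring_scheme \<Rightarrow> ('a \<times> 'a) set ring" where
  "strong_Q_l R = left_localization R (T_l R)"

definition strong_ideal :: "('a, 'm) ring_scheme \<Rightarrow> 'a set" where
  "strong_ideal R = ass R (T_l R)"

text \<open>\<open>GREATEST\<close> is with respect to inclusion.\<close>

definition S_l :: "('a, 'm) ring_scheme \<Rightarrow> 'a set \<Rightarrow> 'a set" where
  "S_l R \<aa> = (GREATEST S. S \<in> Den_l R \<and> ass R S = \<aa>)"

definition Q_la :: "('a, 'm) ring_scheme \<Rightarrow> 'a set \<Rightarrow> ('a \<times> 'a) set ring" where
  "Q_la R \<aa> = left_localization R (S_l R \<aa>)"

definition Q_l :: "('a, 'm) ring_scheme \<Rightarrow> ('a \<times> 'a) set ring" where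
  "Q_l R = Q_la R {\<zero>\<^bsub>R\<^esub>}"

end

theory Submission
  imports Defs "HOL.Hull"
begin

text \<open>
  A submonoid generated by left denominator sets is again one as soon as it avoids \<open>0\<close>.
  If \<open>M\<close> is a left denominator set and all generating sets \<open>S\<close> satisfy
  \<open>ass S \<subseteq> ass M\<close>, then \<open>0\<close> is avoided: from \<open>x\<^sub>1 \<cdots> x\<^sub>n = 0\<close> one peels off the factors
  from the right and gets \<open>x\<^sub>1 \<cdots> x\<^sub>k \<in> ass M\<close> for every \<open>k\<close>, hence \<open>1 \<in> ass M\<close>.
  This yields the existence of the largest set with a given \<open>ass\<close>, and it shows that a left
  denominator set is contained in every maximal \<open>M\<close> whose \<open>ass M\<close> contains \<open>ass S\<close>.
  Applied to \<open>S\<close> the largest set with \<open>ass S = ass (T_l R)\<close>, this places \<open>S\<close> in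
  \<open>strong_L R\<close> and so \<open>S = T_l R\<close>.  The other claims hold for every \<open>S\<close> that is largest for its
  \<open>ass\<close>: the elements of \<open>R\<close> that become units in \<open>S\<^sup>-\<^sup>1R\<close>, and the preimage of the largest
  regular left Ore set of \<open>R / ass S\<close>, are left denominator sets with the same \<open>ass\<close> that
  contain \<open>S\<close>, hence equal \<open>S\<close>.
\<close>

section \<open>Left denominator sets\<close>

context ring
begin

section \<open>Elementwise conditions for left denominator sets and the ideal
  \<open>ass R S\<close>\<close>

lemma Den_l_iff:
  "S \<in> Den_l R \<longleftrightarrow> submonoid S R \<and> \<zero> \<notin> S \<and>
     (\<forall>r\<in>carrier R. \<forall>s\<in>S. \<exists>s'\<in>S. \<exists>r'\<in>carrier R. s' \<otimes> r = r' \<otimes> s) \<and>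
     (\<forall>r\<in>carrier R. \<forall>s\<in>S. r \<otimes> s = \<zero> \<longrightarrow> (\<exists>s'\<in>S. s' \<otimes> r = \<zero>))"
  unfolding Den_l_def left_Ore_set_def multiplicative_subset_def r_coset_def ass_def
  by (auto; blast)

lemma Den_lI:
  assumes "submonoid S R" "\<zero> \<notin> S"
    and "\<And>r s. r \<in> carrier R \<Longrightarrow> s \<in> S \<Longrightarrow> \<exists>s'\<in>S. \<exists>r'\<in>carrier R. s' \<otimes> r = r' \<otimes> s"
    and "\<And>r s. r \<in> carrier R \<Longrightarrow> s \<in> S \<Longrightarrow> r \<otimes> s = \<zero> \<Longrightarrow> \<exists>s'\<in>S. s' \<otimes> r = \<zero>"
  shows "S \<in> Den_l R"
  unfolding Den_l_iff using assms by simp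

lemma in_ass_iff: "r \<in> ass R S \<longleftrightarrow> r \<in> carrier R \<and> (\<exists>s\<in>S. s \<otimes> r = \<zero>)"
  unfolding ass_def by simp

lemma Den_l_submonoid: "S \<in> Den_l R \<Longrightarrow> submonoid S R"
  by (simp add: Den_l_iff)

lemma Den_l_zero: "S \<in> Den_l R \<Longrightarrow> \<zero> \<notin> S"
  by (simp add: Den_l_iff)

lemma Den_l_Ore:
  assumes "S \<in> Den_l R" "r \<in> carrier R" "s \<in> S"
  obtains s' r' where "s' \<in> S" "r' \<in> carrier R" "s' \<otimes> r = r' \<otimes> s"
  using assms unfolding Den_l_iff by blast

lemma Den_l_ass:
  assumes "S \<in> Den_l R" "r \<in> carrier R" "s \<in> S" "r \<otimes> s = \<zero>"
  shows "r \<in> ass R S"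
  using assms unfolding Den_l_iff in_ass_iff by blast

text \<open>The factor \<open>t\<close> annihilates \<open>x \<ominus> y\<close> from the right, so
  the denominator condition supplies a left annihilator \<open>g\<close>. Well-definedness of
  fractions draws on that condition in this form.\<close>

lemma Den_l_cancel:
  assumes S: "S \<in> Den_l R" and c: "x \<in> carrier R" "y \<in> carrier R" and t: "t \<in> S"
    and eq: "x \<otimes> t = y \<otimes> t"
  obtains g where "g \<in> S" "g \<otimes> x = g \<otimes> y"
proof -
  interpret submonoid S R using S by (rule Den_l_submonoid)
  have "(x \<ominus> y) \<otimes> t = x \<otimes> t \<ominus> y \<otimes> t"
    using c t by (simp add: minus_eq l_distr l_minus)
  also have "\<dots> = \<zero>" unfolding eq using c t by (simp add: minus_eq r_neg)
  finally obtain g where g: "g \<in> S" "g \<otimes> (x \<ominus> y) = \<zero>"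
    using Den_l_ass[OF S _ t, of "x \<ominus> y"] c by (auto simp: in_ass_iff)
  then have "g \<otimes> x \<oplus> \<ominus> (g \<otimes> y) = \<zero>"
    using c by (simp add: minus_eq r_distr r_minus)
  then have "\<ominus> (\<ominus> (g \<otimes> y)) = g \<otimes> x" using g c by (intro minus_equality) auto
  then show thesis using that g c by simp
qed

lemma zero_in_ass: "S \<in> Den_l R \<Longrightarrow> \<zero> \<in> ass R S"
  using submonoid.one_closed[OF Den_l_submonoid, of S] by (auto simp: in_ass_iff intro!: bexI[of _ \<one>])

lemma one_notin_ass: "S \<in> Den_l R \<Longrightarrow> \<one> \<notin> ass R S"
  using submonoid.subset[OF Den_l_submonoid] Den_l_zero by (force simp: in_ass_iff)

lemma mult_in_ass_cancel:
  assumes S: "S \<in> Den_l R" and "s \<in> S" "r \<in> carrier R" "s \<otimes> r \<in> ass R S"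
  shows "r \<in> ass R S"
proof -
  interpret submonoid S R using S by (rule Den_l_submonoid)
  obtain t where "t \<in> S" "t \<otimes> (s \<otimes> r) = \<zero>" using assms by (auto simp: in_ass_iff)
  then have "t \<otimes> s \<in> S" "(t \<otimes> s) \<otimes> r = \<zero>" using assms by (auto simp: m_assoc)
  then show ?thesis using assms by (auto simp: in_ass_iff)
qed

text \<open>The peeling step: an \<open>m\<close> in \<open>M\<close> killing
  \<open>x \<otimes> s\<close> gives \<open>(m \<otimes> x) \<otimes> s = \<zero>\<close>, the
  denominator condition for \<open>S\<close> moves \<open>m \<otimes> x\<close> into
  \<open>ass R S\<close>, and inside \<open>ass R M\<close> the factor \<open>m\<close> cancels
  again.\<close>

lemma Den_l_absorb_right:
  assumes S: "S \<in> Den_l R" and M: "M \<in> Den_l R" and le: "ass R S \<subseteq> ass R M"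
    and s: "s \<in> S" and x: "x \<in> carrier R" and xs: "x \<otimes> s \<in> ass R M"
  shows "x \<in> ass R M"
proof -
  interpret S: submonoid S R using S by (rule Den_l_submonoid)
  interpret M: submonoid M R using M by (rule Den_l_submonoid)
  obtain m where m: "m \<in> M" "m \<otimes> (x \<otimes> s) = \<zero>" using xs by (auto simp: in_ass_iff)
  then have "(m \<otimes> x) \<otimes> s = \<zero>" using s x by (simp add: m_assoc)
  then have "m \<otimes> x \<in> ass R S" using Den_l_ass[OF S] m s x by simp
  then show ?thesis using le m x mult_in_ass_cancel[OF M] by blast
qed

lemma ass_ideal:
  assumes S: "S \<in> Den_l R"
  shows "ideal (ass R S) R"
proof -
  interpret submonoid S R using S by (rule Den_l_submonoid)
  have sub: "ass R S \<subseteq> carrier R" by (auto simp: in_ass_iff)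
  have add: "x \<oplus> y \<in> ass R S" if xy: "x \<in> ass R S" "y \<in> ass R S" for x y
  proof -
    obtain s t where st: "s \<in> S" "s \<otimes> x = \<zero>" "t \<in> S" "t \<otimes> y = \<zero>"
      and c: "x \<in> carrier R" "y \<in> carrier R" using xy by (auto simp: in_ass_iff)
    \<comment> \<open>A common left multiple of the two annihilators kills both summands.\<close>
    obtain s' r' where "s' \<in> S" "r' \<in> carrier R" "s' \<otimes> s = r' \<otimes> t"
      using Den_l_Ore[OF S, of s t] st by auto
    note e = this
    have "(s' \<otimes> s) \<otimes> x = \<zero>" using e(1,2) st c by (simp add: m_assoc)
    moreover have "(s' \<otimes> s) \<otimes> y = \<zero>" unfolding e(3) using e(1,2) st c by (simp add: m_assoc)
    ultimately have "(s' \<otimes> s) \<otimes> (x \<oplus> y) = \<zero>" using e(1) st c by (simp add: r_distr)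
    then show ?thesis using e(1) st c by (auto simp: in_ass_iff intro!: bexI[of _ "s' \<otimes> s"])
  qed
  have right: "x \<otimes> r \<in> ass R S" if "x \<in> ass R S" "r \<in> carrier R" for x r
  proof -
    obtain s where s: "s \<in> S" "s \<otimes> x = \<zero>" "x \<in> carrier R" using \<open>x \<in> ass R S\<close> by (auto simp: in_ass_iff)
    then have "s \<otimes> (x \<otimes> r) = \<zero>" using that by (simp add: m_assoc[symmetric])
    then show ?thesis using s that by (auto simp: in_ass_iff)
  qed
  have left: "r \<otimes> x \<in> ass R S" if "x \<in> ass R S" "r \<in> carrier R" for x r
  proof -
    obtain s where s: "s \<in> S" "s \<otimes> x = \<zero>" "x \<in> carrier R" using \<open>x \<in> ass R S\<close> by (auto simp: in_ass_iff)
    \<comment> \<open>The Ore condition carries the annihilator \<open>s\<close> of \<open>x\<close>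
      across \<open>r\<close>.\<close>
    obtain s' r' where e: "s' \<in> S" "r' \<in> carrier R" "s' \<otimes> r = r' \<otimes> s"
      using Den_l_Ore[OF S \<open>r \<in> carrier R\<close> s(1)] .
    have "s' \<otimes> (r \<otimes> x) = (r' \<otimes> s) \<otimes> x" using e s that by (simp add: m_assoc[symmetric])
    also have "\<dots> = r' \<otimes> (s \<otimes> x)" using e(2) s by (simp add: m_assoc)
    finally have "s' \<otimes> (r \<otimes> x) = \<zero>" using e(2) s(2) by simp
    then show ?thesis using e s that by (auto simp: in_ass_iff)
  qed
  show ?thesis
  proof (rule idealI[OF ring_axioms _ left right])
    show "subgroup (ass R S) (add_monoid R)"
    proof (rule group.subgroupI[OF a_group])
      fix a assume a: "a \<in> ass R S"
      then have "a \<otimes> \<ominus> \<one> \<in> ass R S" using right by simp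
      moreover have "a \<otimes> \<ominus> \<one> = \<ominus> a" using a sub by (auto simp: r_minus)
      ultimately show "inv\<^bsub>add_monoid R\<^esub> a \<in> ass R S" by (simp add: a_inv_def)
    qed (use sub add zero_in_ass[OF S] in auto)
  qed
qed

section \<open>Submonoids generated by families of left denominator sets\<close>

lemma submonoid_hull:
  assumes "A \<subseteq> carrier R"
  shows "submonoid ((\<lambda>H. submonoid H R) hull A) R"
proof -
  have c: "submonoid (carrier R) R" by unfold_locales auto
  show ?thesis
  proof
    show "(\<lambda>H. submonoid H R) hull A \<subseteq> carrier R" using assms c by (rule hull_minimal)
    show "x \<otimes> y \<in> (\<lambda>H. submonoid H R) hull A"
      if "x \<in> (\<lambda>H. submonoid H R) hull A" "y \<in> (\<lambda>H. submonoid H R) hull A" for x y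
      using that submonoid.m_closed unfolding hull_def by fastforce
    show "\<one> \<in> (\<lambda>H. submonoid H R) hull A"
      using submonoid.one_closed unfolding hull_def by fastforce
  qed
qed

text \<open>Elements that satisfy the Ore condition with witnesses from \<open>G\<close>, and those
  that satisfy the denominator condition with annihilators from \<open>G\<close>, form submonoids
  \<open>H\<close> and \<open>K\<close> containing the generators. Minimality of the hull, which
  acts as induction on products, gives \<open>G \<subseteq> H\<close> and
  \<open>G \<subseteq> K\<close>.\<close>

lemma generated_Den_l:
  assumes F: "F \<subseteq> Den_l R" and G: "G = (\<lambda>H. submonoid H R) hull \<Union>F" and nz: "\<zero> \<notin> G"
  shows "G \<in> Den_l R"
proof -
  have sub: "\<Union>F \<subseteq> carrier R"
    using F submonoid.subset[OF Den_l_submonoid] by blast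
  interpret submonoid G R unfolding G using sub by (rule submonoid_hull)
  have gen: "S \<subseteq> G" if "S \<in> F" for S unfolding G using that hull_subset[of "\<Union>F"] by blast
  define H where "H = {s \<in> carrier R. \<forall>r\<in>carrier R. \<exists>s'\<in>G. \<exists>r'\<in>carrier R. s' \<otimes> r = r' \<otimes> s}"
  define K where "K = {s \<in> carrier R. \<forall>r\<in>carrier R. r \<otimes> s = \<zero> \<longrightarrow> (\<exists>s'\<in>G. s' \<otimes> r = \<zero>)}"
  have "G \<subseteq> H" unfolding G
  proof (rule hull_minimal)
    show "\<Union>F \<subseteq> H"
    proof
      fix s assume "s \<in> \<Union>F"
      then obtain S where S: "S \<in> F" "s \<in> S" by blast
      have "\<exists>s'\<in>G. \<exists>r'\<in>carrier R. s' \<otimes> r = r' \<otimes> s" if "r \<in> carrier R" for r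
      proof -
        have "S \<in> Den_l R" using S F by blast
        from Den_l_Ore[OF this that S(2)] obtain s' r'
          where "s' \<in> S" "r' \<in> carrier R" "s' \<otimes> r = r' \<otimes> s" .
        then show ?thesis using gen[OF S(1)] by auto
      qed
      then show "s \<in> H" using sub S by (auto simp: H_def)
    qed
    show "submonoid H R"
    proof
      fix x y assume x: "x \<in> H" and y: "y \<in> H"
      then have c: "x \<in> carrier R" "y \<in> carrier R" by (auto simp: H_def)
      have "\<exists>s'\<in>G. \<exists>r'\<in>carrier R. s' \<otimes> r = r' \<otimes> (x \<otimes> y)" if r: "r \<in> carrier R" for r
      proof -
        \<comment> \<open>First \<open>r\<close> is moved across the right factor \<open>y\<close>,
          then the resulting \<open>r1\<close> across \<open>x\<close>; the witnesses multiply to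
          \<open>s2 \<otimes> s1\<close>.\<close>
        obtain s1 r1 where 1: "s1 \<in> G" "r1 \<in> carrier R" "s1 \<otimes> r = r1 \<otimes> y"
          using y r by (auto simp: H_def)
        obtain s2 r2 where 2: "s2 \<in> G" "r2 \<in> carrier R" "s2 \<otimes> r1 = r2 \<otimes> x"
          using x 1(2) by (auto simp: H_def)
        have "s2 \<otimes> s1 \<otimes> r = s2 \<otimes> (r1 \<otimes> y)" using 1 2 r by (simp add: m_assoc)
        also have "\<dots> = (s2 \<otimes> r1) \<otimes> y" using 1(1,2) 2(1,2) c by (simp add: m_assoc)
        also have "\<dots> = r2 \<otimes> (x \<otimes> y)" using 2 c by (simp add: m_assoc)
        finally show ?thesis using 1 2 by blast
      qed
      then show "x \<otimes> y \<in> H" using c by (auto simp: H_def)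
    next
      show "H \<subseteq> carrier R" by (auto simp: H_def)
      have "\<one> \<otimes> r = r \<otimes> \<one>" if "r \<in> carrier R" for r using that by simp
      then show "\<one> \<in> H" using one_closed unfolding H_def by blast
    qed
  qed
  moreover have "G \<subseteq> K" unfolding G
  proof (rule hull_minimal)
    show "\<Union>F \<subseteq> K"
    proof
      fix s assume "s \<in> \<Union>F"
      then obtain S where S: "S \<in> F" "s \<in> S" by blast
      have "\<exists>s'\<in>G. s' \<otimes> r = \<zero>" if "r \<in> carrier R" "r \<otimes> s = \<zero>" for r
        using Den_l_ass[of S r s] S F gen[OF S(1)] that by (auto simp: in_ass_iff)
      then show "s \<in> K" using sub S by (auto simp: K_def)
    qed
    show "submonoid K R"
    proof
      fix x y assume x: "x \<in> K" and y: "y \<in> K"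
      then have c: "x \<in> carrier R" "y \<in> carrier R" by (auto simp: K_def)
      have "\<exists>s'\<in>G. s' \<otimes> r = \<zero>" if r: "r \<in> carrier R" "r \<otimes> (x \<otimes> y) = \<zero>" for r
      proof -
        have "(r \<otimes> x) \<otimes> y = \<zero>" using r c by (simp add: m_assoc)
        moreover have "r \<otimes> x \<in> carrier R" using r c by simp
        ultimately obtain s1 where 1: "s1 \<in> G" "s1 \<otimes> (r \<otimes> x) = \<zero>"
          using y r(1) c unfolding K_def by blast
        then have "(s1 \<otimes> r) \<otimes> x = \<zero>" using r c by (simp add: m_assoc)
        then obtain s2 where 2: "s2 \<in> G" "s2 \<otimes> (s1 \<otimes> r) = \<zero>"
          using x 1 r by (auto simp: K_def)
        then have "(s2 \<otimes> s1) \<otimes> r = \<zero>" using 1 r by (simp add: m_assoc)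
        then show ?thesis using 1 2 by blast
      qed
      then show "x \<otimes> y \<in> K" using c by (auto simp: K_def)
    next
      show "K \<subseteq> carrier R" by (auto simp: K_def)
      have "\<exists>s'\<in>G. s' \<otimes> r = \<zero>" if "r \<in> carrier R" "r \<otimes> \<one> = \<zero>" for r
        using that by (intro bexI[OF _ one_closed]) simp
      then show "\<one> \<in> K" by (auto simp: K_def)
    qed
  qed
  ultimately have HK: "s \<in> H" "s \<in> K" if "s \<in> G" for s using that by auto
  show ?thesis
  proof (rule Den_lI[OF submonoid_axioms nz])
    fix r s assume r: "r \<in> carrier R" and s: "s \<in> G"
    show "\<exists>s'\<in>G. \<exists>r'\<in>carrier R. s' \<otimes> r = r' \<otimes> s" using HK(1)[OF s] r by (simp add: H_def)
    show "\<exists>s'\<in>G. s' \<otimes> r = \<zero>" if "r \<otimes> s = \<zero>" using HK(2)[OF s] r that by (simp add: K_def)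
  qed
qed

lemma generated_nonzero:
  assumes F: "F \<subseteq> Den_l R" and M: "M \<in> Den_l R" and le: "\<And>S. S \<in> F \<Longrightarrow> ass R S \<subseteq> ass R M"
  shows "\<zero> \<notin> (\<lambda>H. submonoid H R) hull \<Union>F"
proof
  assume zero: "\<zero> \<in> (\<lambda>H. submonoid H R) hull \<Union>F"
  \<comment> \<open>Elements that can be cancelled from the right modulo \<open>ass R M\<close>.
    That they form a submonoid replaces stripping the factors off a product one by one.\<close>
  define H where "H = {w \<in> carrier R. \<forall>x\<in>carrier R. x \<otimes> w \<in> ass R M \<longrightarrow> x \<in> ass R M}"
  have "(\<lambda>H. submonoid H R) hull \<Union>F \<subseteq> H"
  proof (rule hull_minimal)
    show "\<Union>F \<subseteq> H"
    proof
      fix w assume "w \<in> \<Union>F"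
      then obtain S where S: "S \<in> F" "w \<in> S" by blast
      then have D: "S \<in> Den_l R" using F by blast
      have "w \<in> carrier R" using S submonoid.subset[OF Den_l_submonoid[OF D]] by blast
      then show "w \<in> H"
        using Den_l_absorb_right[OF D M le[OF S(1)] S(2)] unfolding H_def by blast
    qed
    show "submonoid H R"
    proof
      fix x y assume x: "x \<in> H" and y: "y \<in> H"
      then have c: "x \<in> carrier R" "y \<in> carrier R" by (auto simp: H_def)
      have "z \<in> ass R M" if z: "z \<in> carrier R" "z \<otimes> (x \<otimes> y) \<in> ass R M" for z
      proof -
        have "(z \<otimes> x) \<otimes> y \<in> ass R M" using c z by (simp add: m_assoc)
        moreover have "z \<otimes> x \<in> carrier R" using c z by simp
        ultimately have "z \<otimes> x \<in> ass R M" using y unfolding H_def by blast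
        then show ?thesis using x z unfolding H_def by blast
      qed
      then show "x \<otimes> y \<in> H" using c unfolding H_def by blast
    qed (auto simp: H_def)
  qed
  then have "\<zero> \<in> H" using zero by blast
  \<comment> \<open>Cancel \<open>\<zero>\<close> from \<open>\<one> \<otimes> \<zero>\<close>,
    which lies in \<open>ass R M\<close>.\<close>
  then have "\<one> \<in> ass R M" using zero_in_ass[OF M] by (simp add: H_def)
  then show False using one_notin_ass[OF M] by blast
qed

text \<open>Together \<open>S\<close> and \<open>M\<close> generate a left denominator set, because
  \<open>ass R M\<close> contains the \<open>ass\<close> of both. It contains \<open>M\<close>, so
  maximality makes it equal to \<open>M\<close>.\<close>

lemma Den_l_subset_maximal:
  assumes S: "S \<in> Den_l R" and M: "M \<in> max_Den_l R" and le: "ass R S \<subseteq> ass R M"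
  shows "S \<subseteq> M"
proof -
  define G where "G = (\<lambda>H. submonoid H R) hull \<Union>{S, M}"
  have M': "M \<in> Den_l R" using M by (simp add: max_Den_l_def)
  have F: "{S, M} \<subseteq> Den_l R" using S M' by simp
  have "G \<in> Den_l R"
    by (rule generated_Den_l[OF F G_def], unfold G_def, rule generated_nonzero[OF F M'])
      (use le in blast)
  moreover have "S \<union> M \<subseteq> G" unfolding G_def using hull_subset[of "S \<union> M"] by simp
  ultimately show ?thesis using M by (auto simp: max_Den_l_def)
qed

section \<open>The largest left denominator set with a given \<open>ass\<close>\<close>

lemma ass_mono: "S \<subseteq> T \<Longrightarrow> ass R S \<subseteq> ass R T"
  unfolding in_ass_iff subset_iff by blast

text \<open>The submonoid generated by all competitors is itself a competitor; this is what makes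
  the \<open>GREATEST\<close> in \<open>S_l\<close> meaningful.\<close>

lemma S_l_greatest:
  assumes S: "S \<in> Den_l R"
  shows S_l_Den_l: "S_l R (ass R S) \<in> Den_l R"
    and ass_S_l: "ass R (S_l R (ass R S)) = ass R S"
    and S_l_upper: "\<And>T. T \<in> Den_l R \<Longrightarrow> ass R T = ass R S \<Longrightarrow> T \<subseteq> S_l R (ass R S)"
proof -
  define F where "F = {T \<in> Den_l R. ass R T = ass R S}"
  define G where "G = (\<lambda>H. submonoid H R) hull \<Union>F"
  have F: "F \<subseteq> Den_l R" by (auto simp: F_def)
  have G: "G \<in> Den_l R"
    by (rule generated_Den_l[OF F G_def], unfold G_def, rule generated_nonzero[OF F S])
      (simp add: F_def)
  have up: "T \<subseteq> G" if "T \<in> F" for T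
    using that hull_subset[of "\<Union>F"] unfolding G_def by blast
  \<comment> \<open>Now cancellation is from the left, modulo \<open>ass R S\<close>. Each generator
    allows it, hence so does every \<open>g\<close> in \<open>G\<close>, and
    \<open>g \<otimes> x = \<zero>\<close> forces \<open>x\<close> into
    \<open>ass R S\<close>.\<close>
  define H where "H = {w \<in> carrier R. \<forall>x\<in>carrier R. w \<otimes> x \<in> ass R S \<longrightarrow> x \<in> ass R S}"
  have "G \<subseteq> H" unfolding G_def
  proof (rule hull_minimal)
    show "\<Union>F \<subseteq> H"
    proof
      fix w assume "w \<in> \<Union>F"
      then obtain T where T: "T \<in> Den_l R" "ass R T = ass R S" "w \<in> T"
        unfolding F_def by blast
      then have "w \<in> carrier R" using submonoid.subset[OF Den_l_submonoid] by blast
      then show "w \<in> H"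
        using mult_in_ass_cancel[OF T(1) T(3)] unfolding H_def T(2) by blast
    qed
    show "submonoid H R"
    proof
      fix x y assume x: "x \<in> H" and y: "y \<in> H"
      then have c: "x \<in> carrier R" "y \<in> carrier R" by (auto simp: H_def)
      have "z \<in> ass R S" if z: "z \<in> carrier R" "(x \<otimes> y) \<otimes> z \<in> ass R S" for z
      proof -
        have "x \<otimes> (y \<otimes> z) \<in> ass R S" using c z by (simp add: m_assoc)
        moreover have "y \<otimes> z \<in> carrier R" using c z by simp
        ultimately have "y \<otimes> z \<in> ass R S" using x unfolding H_def by blast
        then show ?thesis using y z unfolding H_def by blast
      qed
      then show "x \<otimes> y \<in> H" using c unfolding H_def by blast
    qed (auto simp: H_def)
  qed
  have "x \<in> ass R S" if x: "x \<in> ass R G" for x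
  proof -
    obtain g where g: "g \<in> G" "g \<otimes> x = \<zero>" "x \<in> carrier R"
      using x unfolding in_ass_iff by blast
    then have "g \<otimes> x \<in> ass R S" using zero_in_ass[OF S] by simp
    then show ?thesis using g \<open>G \<subseteq> H\<close> unfolding H_def by blast
  qed
  then have "ass R G \<subseteq> ass R S" by blast
  moreover have "ass R S \<subseteq> ass R G" using S up by (intro ass_mono) (simp add: F_def)
  ultimately have aG: "ass R G = ass R S" by blast
  have eq: "S_l R (ass R S) = G"
    unfolding S_l_def by (rule Greatest_equality) (use G aG up in \<open>simp_all add: F_def\<close>)
  show "S_l R (ass R S) \<in> Den_l R" unfolding eq by (rule G)
  show "ass R (S_l R (ass R S)) = ass R S" unfolding eq by (rule aG)
  show "T \<subseteq> S_l R (ass R S)" if "T \<in> Den_l R" "ass R T = ass R S" for T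
    unfolding eq using that by (intro up) (simp add: F_def)
qed

section \<open>Maximal left denominator sets and \<open>T_l R\<close>\<close>

lemma Den_l_Union_chain:
  assumes ne: "C \<noteq> {}" and C: "subset.chain (Den_l R) C"
  shows "\<Union>C \<in> Den_l R"
proof -
  have D: "S \<in> Den_l R" if "S \<in> C" for S using C that by (auto simp: subset.chain_def)
  have "submonoid (\<Union>C) R"
  proof
    show "\<Union>C \<subseteq> carrier R" using D submonoid.subset[OF Den_l_submonoid] by blast
    show "\<one> \<in> \<Union>C" using ne D submonoid.one_closed[OF Den_l_submonoid] by blast
    fix x y assume "x \<in> \<Union>C" "y \<in> \<Union>C"
    \<comment> \<open>Two members of a chain are comparable, so the larger one contains both
      factors.\<close>
    then obtain S where "S \<in> C" "x \<in> S" "y \<in> S" using C unfolding subset_chain_def by blast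
    then show "x \<otimes> y \<in> \<Union>C" using D submonoid.m_closed[OF Den_l_submonoid] by blast
  qed
  moreover have "\<zero> \<notin> \<Union>C" using D Den_l_zero by blast
  moreover have "\<exists>s'\<in>\<Union>C. \<exists>r'\<in>carrier R. s' \<otimes> r = r' \<otimes> s"
    if r: "r \<in> carrier R" and s: "s \<in> \<Union>C" for r s
  proof -
    obtain S where S: "S \<in> C" "s \<in> S" using s by blast
    from Den_l_Ore[OF D[OF S(1)] r S(2)] show ?thesis using S(1) by blast
  qed
  moreover have "\<exists>s'\<in>\<Union>C. s' \<otimes> r = \<zero>"
    if r: "r \<in> carrier R" and s: "s \<in> \<Union>C" and rs: "r \<otimes> s = \<zero>" for r s
  proof -
    obtain S where S: "S \<in> C" "s \<in> S" using s by blast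
    from Den_l_ass[OF D[OF S(1)] r S(2) rs] show ?thesis
      using S(1) unfolding in_ass_iff by blast
  qed
  ultimately show ?thesis by (rule Den_lI)
qed

text \<open>Zorn's lemma, started from the left denominator set \<open>{\<one>}\<close>. The
  existence of a maximal set is what keeps \<open>\<zero>\<close> out of
  \<open>strong_L R\<close>.\<close>

lemma max_Den_l_nonempty:
  assumes "\<one> \<noteq> \<zero>"
  shows "max_Den_l R \<noteq> {}"
proof -
  have "{\<one>} \<in> Den_l R" using assms unfolding Den_l_iff submonoid_def by auto
  then show ?thesis
    using subset_Zorn_nonempty[of "Den_l R"] Den_l_Union_chain unfolding max_Den_l_def by blast
qed

text \<open>A union of submonoids is not visibly closed under products, so the submonoid
  \<open>G\<close> generated by it is used. It stays inside the submonoid \<open>strong_L R\<close>,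
  hence avoids \<open>\<zero>\<close>, is a left denominator set, and is thus itself one of the sets
  united in \<open>T_l R\<close>.\<close>

lemma T_l_Den_l:
  assumes "\<one> \<noteq> \<zero>"
  shows "T_l R \<in> Den_l R" and "T_l R \<subseteq> strong_L R"
proof -
  obtain M where M: "M \<in> max_Den_l R" using max_Den_l_nonempty[OF assms] by blast
  have D: "S \<in> Den_l R" if "S \<in> max_Den_l R" for S using that by (simp add: max_Den_l_def)
  have nz: "\<zero> \<notin> strong_L R" using M D Den_l_zero unfolding strong_L_def by blast
  have sub: "submonoid (strong_L R) R"
    using M D Den_l_submonoid unfolding strong_L_def submonoid_def by blast
  define F where "F = {S \<in> Den_l R. S \<subseteq> strong_L R}"
  define G where "G = (\<lambda>H. submonoid H R) hull \<Union>F"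
  have le: "G \<subseteq> strong_L R" unfolding G_def
    by (rule hull_minimal) (use sub in \<open>auto simp: F_def\<close>)
  have "F \<subseteq> Den_l R" by (auto simp: F_def)
  then have "G \<in> Den_l R" by (rule generated_Den_l[OF _ G_def]) (use le nz in blast)
  moreover have "T_l R = G"
    using calculation le hull_subset[of "\<Union>F"] unfolding T_l_def G_def F_def by blast
  ultimately show "T_l R \<in> Den_l R" and "T_l R \<subseteq> strong_L R" using le by auto
qed

lemma T_l_eq_S_l:
  assumes "\<one> \<noteq> \<zero>"
  shows "T_l R = S_l R (strong_ideal R)"
proof
  note T = T_l_Den_l[OF assms]
  note S = S_l_greatest[OF T(1), folded strong_ideal_def]
  show "T_l R \<subseteq> S_l R (strong_ideal R)" using S(3) T(1) by (simp add: strong_ideal_def)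
  \<comment> \<open>Both \<open>S_l R (strong_ideal R)\<close> and \<open>T_l R\<close> have the
    same \<open>ass\<close>, and \<open>T_l R\<close> lies in \<open>M\<close>; monotonicity of
    \<open>ass\<close> then gives the comparison that \<open>Den_l_subset_maximal\<close> asks
    for.\<close>
  have "S_l R (strong_ideal R) \<subseteq> M" if M: "M \<in> max_Den_l R" for M
  proof (rule Den_l_subset_maximal[OF S(1) M])
    have "T_l R \<subseteq> M" using T(2) M by (auto simp: strong_L_def)
    then show "ass R (S_l R (strong_ideal R)) \<subseteq> ass R M"
      unfolding S(2) unfolding strong_ideal_def by (rule ass_mono)
  qed
  then show "S_l R (strong_ideal R) \<subseteq> T_l R" using S(1) by (auto simp: T_l_def strong_L_def)
qed

end

section \<open>The left localization\<close>

locale left_denominator_set = ring R for R (structure) +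
  fixes S
  assumes Den: "S \<in> Den_l R"
begin

sublocale S: submonoid S R
  using Den by (rule Den_l_submonoid)

abbreviation frac :: "'a \<Rightarrow> 'a \<Rightarrow> ('a \<times> 'a) set" where
  "frac s r \<equiv> left_frac R S s r"

abbreviation Loc :: "('a \<times> 'a) set ring" where
  "Loc \<equiv> left_localization R S"

section \<open>Equality of fractions\<close>

lemma left_frac_rel_iff:
  "((s, r), (t, q)) \<in> left_frac_rel R S \<longleftrightarrow> s \<in> S \<and> r \<in> carrier R \<and> t \<in> S \<and> q \<in> carrier R \<and>
     (\<exists>a\<in>carrier R. \<exists>b\<in>carrier R. a \<otimes> s = b \<otimes> t \<and> a \<otimes> s \<in> S \<and> a \<otimes> r = b \<otimes> q)"
  by (simp add: left_frac_rel_def)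

lemma left_frac_relI:
  assumes "s \<in> S" "r \<in> carrier R" "t \<in> S" "q \<in> carrier R" "a \<in> carrier R" "b \<in> carrier R"
    "a \<otimes> s = b \<otimes> t" "a \<otimes> s \<in> S" "a \<otimes> r = b \<otimes> q"
  shows "((s, r), (t, q)) \<in> left_frac_rel R S"
  using assms unfolding left_frac_rel_iff by blast

lemma left_frac_relE:
  assumes "((s, r), (t, q)) \<in> left_frac_rel R S"
  obtains a b where "s \<in> S" "r \<in> carrier R" "t \<in> S" "q \<in> carrier R" "a \<in> carrier R" "b \<in> carrier R"
    "a \<otimes> s = b \<otimes> t" "a \<otimes> s \<in> S" "a \<otimes> r = b \<otimes> q"
  using assms unfolding left_frac_rel_iff by blast

text \<open>The two relations expand the middle denominator to \<open>b \<otimes> t\<close> and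
  \<open>c \<otimes> t\<close>, which \<open>e\<close> and \<open>f\<close> bring to a common left
  multiple. Cancelling \<open>t\<close> costs a left factor \<open>g\<close>; then
  \<open>g \<otimes> (e \<otimes> a)\<close> and \<open>g \<otimes> (f \<otimes> d)\<close> relate
  the outer fractions.\<close>

lemma left_frac_rel_trans:
  assumes 1: "((s, r), (t, q)) \<in> left_frac_rel R S" and 2: "((t, q), (u, p)) \<in> left_frac_rel R S"
  shows "((s, r), (u, p)) \<in> left_frac_rel R S"
proof -
  from 1 obtain a b where ab: "s \<in> S" "r \<in> carrier R" "t \<in> S" "q \<in> carrier R"
    "a \<in> carrier R" "b \<in> carrier R" "a \<otimes> s = b \<otimes> t" "a \<otimes> s \<in> S" "a \<otimes> r = b \<otimes> q"
    by (rule left_frac_relE)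
  from 2 obtain c d where cd: "u \<in> S" "p \<in> carrier R" "c \<in> carrier R" "d \<in> carrier R"
    "c \<otimes> t = d \<otimes> u" "c \<otimes> t \<in> S" "c \<otimes> q = d \<otimes> p"
    by (rule left_frac_relE)
  have "b \<otimes> t \<in> carrier R" using ab by simp
  from Den_l_Ore[OF Den this cd(6)] obtain e f
    where ef: "e \<in> S" "f \<in> carrier R" "e \<otimes> (b \<otimes> t) = f \<otimes> (c \<otimes> t)" .
  have "(e \<otimes> b) \<otimes> t = (f \<otimes> c) \<otimes> t" using ef ab(3,6) cd(3) by (simp add: m_assoc)
  from Den_l_cancel[OF Den _ _ ab(3) this] obtain g
    where g: "g \<in> S" "g \<otimes> (e \<otimes> b) = g \<otimes> (f \<otimes> c)"
    using ef(1,2) ab(6) cd(3) by auto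
  have cR: "e \<in> carrier R" "g \<in> carrier R" "s \<in> carrier R" "t \<in> carrier R" "u \<in> carrier R"
    using ef(1) g(1) ab cd by auto
  \<comment> \<open>Used for the denominators \<open>s\<close>, \<open>t\<close>, \<open>u\<close>
    and again for the numerators \<open>r\<close>, \<open>q\<close>, \<open>p\<close>.\<close>
  have move: "(g \<otimes> (e \<otimes> a)) \<otimes> x = (g \<otimes> (f \<otimes> d)) \<otimes> z"
    if "a \<otimes> x = b \<otimes> y" "c \<otimes> y = d \<otimes> z" "x \<in> carrier R" "y \<in> carrier R" "z \<in> carrier R" for x y z
  proof -
    have "(g \<otimes> (e \<otimes> a)) \<otimes> x = g \<otimes> (e \<otimes> (a \<otimes> x))" using that(3) ab(5) cR by (simp add: m_assoc)
    also have "\<dots> = (g \<otimes> (e \<otimes> b)) \<otimes> y" unfolding that(1) using that(4) ab(6) cR by (simp add: m_assoc)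
    also have "\<dots> = g \<otimes> (f \<otimes> (c \<otimes> y))"
      unfolding g(2) using that(4) ef(2) cd(3) cR by (simp add: m_assoc)
    also have "\<dots> = (g \<otimes> (f \<otimes> d)) \<otimes> z"
      unfolding that(2) using that(5) ef(2) cd(4) cR by (simp add: m_assoc)
    finally show ?thesis .
  qed
  show ?thesis
  proof (rule left_frac_relI)
    have "(g \<otimes> (e \<otimes> a)) \<otimes> s = g \<otimes> (e \<otimes> (a \<otimes> s))" using ab(5) cR by (simp add: m_assoc)
    then show "(g \<otimes> (e \<otimes> a)) \<otimes> s \<in> S" using g(1) ef(1) ab(8) by simp
    show "(g \<otimes> (e \<otimes> a)) \<otimes> s = (g \<otimes> (f \<otimes> d)) \<otimes> u"
      by (rule move[OF ab(7) cd(5)]) (use cR in auto)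
    show "(g \<otimes> (e \<otimes> a)) \<otimes> r = (g \<otimes> (f \<otimes> d)) \<otimes> p"
      by (rule move[OF ab(9) cd(7)]) (use ab cd in auto)
  qed (use ab cd ef(2) cR in auto)
qed

lemma left_frac_rel_equiv: "equiv (S \<times> carrier R) (left_frac_rel R S)"
proof (rule equivI)
  show "left_frac_rel R S \<subseteq> (S \<times> carrier R) \<times> S \<times> carrier R"
    unfolding left_frac_rel_def by blast
  show "refl_on (S \<times> carrier R) (left_frac_rel R S)"
  proof (rule refl_onI)
    fix x assume "x \<in> S \<times> carrier R"
    then obtain s r where "x = (s, r)" "s \<in> S" "r \<in> carrier R" by blast
    then show "(x, x) \<in> left_frac_rel R S"
      by (auto intro: left_frac_relI[of _ _ _ _ \<one> \<one>])
  qed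
  show "sym (left_frac_rel R S)"
  proof (rule symI)
    fix x y assume xy: "(x, y) \<in> left_frac_rel R S"
    obtain s r t q where e: "x = (s, r)" "y = (t, q)" by (cases x, cases y)
    from xy[unfolded e] obtain a b where "s \<in> S" "r \<in> carrier R" "t \<in> S" "q \<in> carrier R"
      "a \<in> carrier R" "b \<in> carrier R" "a \<otimes> s = b \<otimes> t" "a \<otimes> s \<in> S" "a \<otimes> r = b \<otimes> q"
      by (rule left_frac_relE)
    then show "(y, x) \<in> left_frac_rel R S" unfolding e
      by (intro left_frac_relI[of t q s r b a]) simp_all
  qed
  show "trans (left_frac_rel R S)"
    by (rule transI) (metis left_frac_rel_trans surj_pair)
qed

lemma mem_frac_iff: "(t, q) \<in> frac s r \<longleftrightarrow> ((s, r), (t, q)) \<in> left_frac_rel R S"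
  by (simp add: left_frac_def)

lemma frac_eq_iff_rel:
  assumes "s \<in> S" "r \<in> carrier R" "t \<in> S" "q \<in> carrier R"
  shows "frac s r = frac t q \<longleftrightarrow> ((s, r), (t, q)) \<in> left_frac_rel R S"
  unfolding left_frac_def using eq_equiv_class_iff[OF left_frac_rel_equiv] assms by simp

lemma frac_self: "s \<in> S \<Longrightarrow> r \<in> carrier R \<Longrightarrow> (s, r) \<in> frac s r"
  using frac_eq_iff_rel[of s r s r] by (simp add: mem_frac_iff)

lemma frac_eqI:
  assumes "s \<in> S" "r \<in> carrier R" "t \<in> S" "q \<in> carrier R" "a \<in> carrier R" "b \<in> carrier R"
    "a \<otimes> s = b \<otimes> t" "a \<otimes> s \<in> S" "a \<otimes> r = b \<otimes> q"
  shows "frac s r = frac t q"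
  unfolding frac_eq_iff_rel[OF assms(1-4)] by (rule left_frac_relI[OF assms])

text \<open>Denominators one force the two expanding factors to coincide, so a single element of
  \<open>S\<close> witnesses equality. The kernel of \<open>\<sigma>\<close> is read off from this
  in \<open>frac_one_zero_iff\<close>.\<close>

lemma frac_one_eq_iff:
  assumes "r \<in> carrier R" "q \<in> carrier R"
  shows "frac \<one> r = frac \<one> q \<longleftrightarrow> (\<exists>s\<in>S. s \<otimes> r = s \<otimes> q)"
proof
  assume "frac \<one> r = frac \<one> q"
  then have "((\<one>, r), (\<one>, q)) \<in> left_frac_rel R S" using assms frac_eq_iff_rel by simp
  then obtain a b where "a \<in> carrier R" "b \<in> carrier R" "a \<otimes> \<one> = b \<otimes> \<one>" "a \<otimes> \<one> \<in> S"
    "a \<otimes> r = b \<otimes> q" by (rule left_frac_relE)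
  then show "\<exists>s\<in>S. s \<otimes> r = s \<otimes> q" by auto
next
  assume "\<exists>s\<in>S. s \<otimes> r = s \<otimes> q"
  then obtain s where "s \<in> S" "s \<otimes> r = s \<otimes> q" ..
  then show "frac \<one> r = frac \<one> q" using assms by (intro frac_eqI[of _ _ _ _ s s]) auto
qed

section \<open>Multiplication and addition of fractions\<close>

lemma frac_mult_expand:
  assumes c: "s \<in> S" "r \<in> carrier R" "t \<in> S" "q \<in> carrier R"
    and ab: "a \<in> S" "b \<in> carrier R" "a \<otimes> r = b \<otimes> t"
    and xy: "x \<in> carrier R" "y \<in> carrier R" "x \<otimes> s \<in> S" "y \<otimes> t \<in> S"
    and cd: "c \<in> S" "d \<in> carrier R" "c \<otimes> (x \<otimes> r) = d \<otimes> (y \<otimes> t)"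
  shows "frac (a \<otimes> s) (b \<otimes> q) = frac (c \<otimes> (x \<otimes> s)) (d \<otimes> (y \<otimes> q))"
proof -
  \<comment> \<open>The right-hand side is the product formed after expanding the two fractions by
    \<open>x\<close> and \<open>y\<close>. An Ore equation for \<open>c \<otimes> x\<close> and
    \<open>a\<close> makes the denominators agree; the numerator factors
    \<open>e \<otimes> (d \<otimes> y)\<close> and \<open>f \<otimes> b\<close> then agree after
    right multiplication by \<open>t\<close>, hence up to a left factor \<open>g\<close>.\<close>
  have "c \<otimes> x \<in> carrier R" using cd xy by simp
  from Den_l_Ore[OF Den this ab(1)] obtain e f
    where ef: "e \<in> S" "f \<in> carrier R" "e \<otimes> (c \<otimes> x) = f \<otimes> a" .
  have cR: "a \<in> carrier R" "c \<in> carrier R" "e \<in> carrier R" "s \<in> carrier R" "t \<in> carrier R"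
    using ab cd ef(1) c by auto
  have "(e \<otimes> (d \<otimes> y)) \<otimes> t = e \<otimes> (d \<otimes> (y \<otimes> t))" using cd(2) xy(2) cR by (simp add: m_assoc)
  also have "\<dots> = (e \<otimes> (c \<otimes> x)) \<otimes> r"
    unfolding cd(3)[symmetric] using xy(1) cR c(2) by (simp add: m_assoc)
  also have "\<dots> = f \<otimes> (a \<otimes> r)" unfolding ef(3) using ef(2) cR c(2) by (simp add: m_assoc)
  also have "\<dots> = (f \<otimes> b) \<otimes> t" unfolding ab(3) using ef(2) ab(2) cR by (simp add: m_assoc)
  finally have "(e \<otimes> (d \<otimes> y)) \<otimes> t = (f \<otimes> b) \<otimes> t" .
  from Den_l_cancel[OF Den _ _ c(3) this] obtain g
    where g: "g \<in> S" "g \<otimes> (e \<otimes> (d \<otimes> y)) = g \<otimes> (f \<otimes> b)"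
    using ef(2) ab(2) cd(2) xy(2) cR by auto
  have gR: "g \<in> carrier R" using g(1) by simp
  show ?thesis
  proof (rule frac_eqI)
    have "(g \<otimes> f) \<otimes> (a \<otimes> s) = g \<otimes> ((f \<otimes> a) \<otimes> s)" using ef(2) cR gR by (simp add: m_assoc)
    also have "\<dots> = (g \<otimes> e) \<otimes> (c \<otimes> (x \<otimes> s))"
      unfolding ef(3)[symmetric] using xy(1) cR gR by (simp add: m_assoc)
    finally show *: "(g \<otimes> f) \<otimes> (a \<otimes> s) = (g \<otimes> e) \<otimes> (c \<otimes> (x \<otimes> s))" .
    show "(g \<otimes> f) \<otimes> (a \<otimes> s) \<in> S" unfolding * using g(1) ef(1) cd(1) xy(3) by simp
    have "(g \<otimes> f) \<otimes> (b \<otimes> q) = (g \<otimes> (f \<otimes> b)) \<otimes> q"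
      using ef(2) ab(2) c(4) gR by (simp add: m_assoc)
    also have "\<dots> = (g \<otimes> e) \<otimes> (d \<otimes> (y \<otimes> q))"
      unfolding g(2)[symmetric] using cd(2) xy(2) c(4) cR gR by (simp add: m_assoc)
    finally show "(g \<otimes> f) \<otimes> (b \<otimes> q) = (g \<otimes> e) \<otimes> (d \<otimes> (y \<otimes> q))" .
  qed (use ab(1,2) c(1,4) xy cd(1,2) ef(1,2) gR in auto)
qed

text \<open>Representatives of the same fraction have a common expansion, so both products are
  compared with the one computed from the expanded representatives.\<close>

lemma frac_mult_cong:
  assumes sr: "((s, r), (s', r')) \<in> left_frac_rel R S" and tq: "((t, q), (t', q')) \<in> left_frac_rel R S"
    and ab: "a \<in> S" "b \<in> carrier R" "a \<otimes> r = b \<otimes> t"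
    and ab': "a' \<in> S" "b' \<in> carrier R" "a' \<otimes> r' = b' \<otimes> t'"
  shows "frac (a \<otimes> s) (b \<otimes> q) = frac (a' \<otimes> s') (b' \<otimes> q')"
proof -
  from sr obtain x x' where x: "s \<in> S" "r \<in> carrier R" "s' \<in> S" "r' \<in> carrier R"
    "x \<in> carrier R" "x' \<in> carrier R" "x \<otimes> s = x' \<otimes> s'" "x \<otimes> s \<in> S" "x \<otimes> r = x' \<otimes> r'"
    by (rule left_frac_relE)
  from tq obtain y y' where y: "t \<in> S" "q \<in> carrier R" "t' \<in> S" "q' \<in> carrier R"
    "y \<in> carrier R" "y' \<in> carrier R" "y \<otimes> t = y' \<otimes> t'" "y \<otimes> t \<in> S" "y \<otimes> q = y' \<otimes> q'"
    by (rule left_frac_relE)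
  have "x \<otimes> r \<in> carrier R" using x by simp
  from Den_l_Ore[OF Den this y(8)] obtain c d
    where cd: "c \<in> S" "d \<in> carrier R" "c \<otimes> (x \<otimes> r) = d \<otimes> (y \<otimes> t)" .
  have "frac (a \<otimes> s) (b \<otimes> q) = frac (c \<otimes> (x \<otimes> s)) (d \<otimes> (y \<otimes> q))"
    by (rule frac_mult_expand[OF x(1,2) y(1,2) ab x(5) y(5) x(8) y(8) cd])
  also have "\<dots> = frac (a' \<otimes> s') (b' \<otimes> q')"
    unfolding x(7) y(9) using x(7-9) y(7-9) cd
    by (intro frac_mult_expand[OF x(3,4) y(3,4) ab' x(6) y(6), symmetric]) simp_all
  finally show ?thesis .
qed

text \<open>Independence of all choices collapses the union in \<open>left_frac_mult\<close> to the
  class given by any admissible \<open>a\<close> and \<open>b\<close>.\<close>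

lemma frac_mult:
  assumes "s \<in> S" "r \<in> carrier R" "t \<in> S" "q \<in> carrier R" "a \<in> S" "b \<in> carrier R" "a \<otimes> r = b \<otimes> t"
  shows "frac s r \<otimes>\<^bsub>Loc\<^esub> frac t q = frac (a \<otimes> s) (b \<otimes> q)"
proof -
  have "left_frac_mult R S (frac s r) (frac t q) = frac (a \<otimes> s) (b \<otimes> q)"
  proof (intro equalityI subsetI)
    fix z assume "z \<in> left_frac_mult R S (frac s r) (frac t q)"
    then obtain s' r' t' q' a' b' where *:
      "(s', r') \<in> frac s r" "(t', q') \<in> frac t q" "a' \<in> S" "b' \<in> carrier R"
      "a' \<otimes> r' = b' \<otimes> t'" "z \<in> frac (a' \<otimes> s') (b' \<otimes> q')"
      unfolding left_frac_mult_def by blast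
    show "z \<in> frac (a \<otimes> s) (b \<otimes> q)"
      using frac_mult_cong[OF *(1,2)[unfolded mem_frac_iff] assms(5-7) *(3-5)] *(6) by simp
  next
    fix z assume "z \<in> frac (a \<otimes> s) (b \<otimes> q)"
    then show "z \<in> left_frac_mult R S (frac s r) (frac t q)"
      unfolding left_frac_mult_def
      using frac_self[OF assms(1,2)] frac_self[OF assms(3,4)] assms(5-7) by blast
  qed
  then show ?thesis by (simp add: left_localization_def)
qed

text \<open>The Ore condition makes the two common denominators equal through \<open>e\<close> and
  \<open>f\<close>. The expanding factors must then agree both over \<open>s\<close> and over
  \<open>t\<close>: \<open>g\<close> achieves the first, a further \<open>h\<close> the second, and
  \<open>u\<close> and \<open>v\<close> collect all of these.\<close>

lemma frac_add_unique:
  assumes c: "s \<in> S" "r \<in> carrier R" "t \<in> S" "q \<in> carrier R"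
    and ab: "a \<in> carrier R" "b \<in> carrier R" "a \<otimes> s = b \<otimes> t" "a \<otimes> s \<in> S"
    and cd: "c \<in> carrier R" "d \<in> carrier R" "c \<otimes> s = d \<otimes> t" "c \<otimes> s \<in> S"
  shows "frac (a \<otimes> s) (a \<otimes> r \<oplus> b \<otimes> q) = frac (c \<otimes> s) (c \<otimes> r \<oplus> d \<otimes> q)"
proof -
  have "a \<otimes> s \<in> carrier R" using ab(4) by simp
  from Den_l_Ore[OF Den this cd(4)] obtain e f
    where ef: "e \<in> S" "f \<in> carrier R" "e \<otimes> (a \<otimes> s) = f \<otimes> (c \<otimes> s)" .
  have cR: "e \<in> carrier R" "s \<in> carrier R" "t \<in> carrier R" using ef(1) c by auto
  have "(e \<otimes> a) \<otimes> s = (f \<otimes> c) \<otimes> s" using ef(2,3) ab(1) cd(1) cR by (simp add: m_assoc)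
  from Den_l_cancel[OF Den _ _ c(1) this] obtain g
    where g: "g \<in> S" "g \<otimes> (e \<otimes> a) = g \<otimes> (f \<otimes> c)"
    using ef(2) ab(1) cd(1) cR by auto
  have gR: "g \<in> carrier R" using g(1) by simp
  have "(g \<otimes> (e \<otimes> b)) \<otimes> t = g \<otimes> (e \<otimes> (b \<otimes> t))" using ab(2) gR cR by (simp add: m_assoc)
  also have "\<dots> = g \<otimes> (f \<otimes> (d \<otimes> t))" unfolding ab(3)[symmetric] cd(3)[symmetric] ef(3) ..
  also have "\<dots> = (g \<otimes> (f \<otimes> d)) \<otimes> t" using cd(2) ef(2) gR cR by (simp add: m_assoc)
  finally have "(g \<otimes> (e \<otimes> b)) \<otimes> t = (g \<otimes> (f \<otimes> d)) \<otimes> t" .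
  from Den_l_cancel[OF Den _ _ c(3) this] obtain h
    where h: "h \<in> S" "h \<otimes> (g \<otimes> (e \<otimes> b)) = h \<otimes> (g \<otimes> (f \<otimes> d))"
    using ef(2) ab(2) cd(2) cR gR by auto
  have hR: "h \<in> carrier R" using h(1) by simp
  define u v where uv: "u = h \<otimes> (g \<otimes> e)" "v = h \<otimes> (g \<otimes> f)"
  have u: "u \<in> S" "u \<in> carrier R" "v \<in> carrier R" using h(1) g(1) ef(1,2) by (auto simp: uv)
  have ua: "u \<otimes> a = v \<otimes> c"
  proof -
    have "u \<otimes> a = h \<otimes> (g \<otimes> (e \<otimes> a))" using ab(1) gR hR cR by (simp add: uv m_assoc)
    also have "\<dots> = v \<otimes> c" unfolding g(2) using cd(1) ef(2) gR hR by (simp add: uv m_assoc)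
    finally show ?thesis .
  qed
  have ub: "u \<otimes> b = v \<otimes> d"
  proof -
    have "u \<otimes> b = h \<otimes> (g \<otimes> (e \<otimes> b))" using ab(2) gR hR cR by (simp add: uv m_assoc)
    also have "\<dots> = v \<otimes> d" unfolding h(2) using cd(2) ef(2) gR hR by (simp add: uv m_assoc)
    finally show ?thesis .
  qed
  have move: "u \<otimes> (a \<otimes> x) = v \<otimes> (c \<otimes> x)" "u \<otimes> (b \<otimes> x) = v \<otimes> (d \<otimes> x)" if "x \<in> carrier R" for x
    using that ua ub ab(1,2) cd(1,2) u by (simp_all add: m_assoc[symmetric])
  have "v \<otimes> (c \<otimes> s) \<in> S"
    unfolding move(1)[OF cR(2), symmetric] using u(1) ab(4) by simp
  then show ?thesis
    by (intro frac_eqI[of _ _ _ _ u v])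
      (use move[OF c(2)] move[OF c(4)] move[OF cR(2)] c ab(1,2,4) cd(1,2,4) u in
        \<open>auto simp: r_distr\<close>)
qed

text \<open>As for products, both sums are compared with one sum over a common denominator of the
  expanded fractions.\<close>

lemma frac_add_cong:
  assumes sr: "((s, r), (s', r')) \<in> left_frac_rel R S" and tq: "((t, q), (t', q')) \<in> left_frac_rel R S"
    and ab: "a \<in> carrier R" "b \<in> carrier R" "a \<otimes> s = b \<otimes> t" "a \<otimes> s \<in> S"
    and ab': "a' \<in> carrier R" "b' \<in> carrier R" "a' \<otimes> s' = b' \<otimes> t'" "a' \<otimes> s' \<in> S"
  shows "frac (a \<otimes> s) (a \<otimes> r \<oplus> b \<otimes> q) = frac (a' \<otimes> s') (a' \<otimes> r' \<oplus> b' \<otimes> q')"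
proof -
  from sr obtain x x' where x: "s \<in> S" "r \<in> carrier R" "s' \<in> S" "r' \<in> carrier R"
    "x \<in> carrier R" "x' \<in> carrier R" "x \<otimes> s = x' \<otimes> s'" "x \<otimes> s \<in> S" "x \<otimes> r = x' \<otimes> r'"
    by (rule left_frac_relE)
  from tq obtain y y' where y: "t \<in> S" "q \<in> carrier R" "t' \<in> S" "q' \<in> carrier R"
    "y \<in> carrier R" "y' \<in> carrier R" "y \<otimes> t = y' \<otimes> t'" "y \<otimes> t \<in> S" "y \<otimes> q = y' \<otimes> q'"
    by (rule left_frac_relE)
  have "x \<otimes> s \<in> carrier R" using x(8) by simp
  from Den_l_Ore[OF Den this y(8)] obtain c d
    where cd: "c \<in> S" "d \<in> carrier R" "c \<otimes> (x \<otimes> s) = d \<otimes> (y \<otimes> t)" .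
  have cR: "c \<in> carrier R" "s \<in> carrier R" "s' \<in> carrier R" "t \<in> carrier R" "t' \<in> carrier R"
    using cd(1) x y by auto
  have x': "(c \<otimes> x) \<otimes> s = (c \<otimes> x') \<otimes> s'" "(c \<otimes> x) \<otimes> r = (c \<otimes> x') \<otimes> r'"
    using x cR by (simp_all add: m_assoc)
  have y': "(d \<otimes> y) \<otimes> t = (d \<otimes> y') \<otimes> t'" "(d \<otimes> y) \<otimes> q = (d \<otimes> y') \<otimes> q'"
    using y cR cd(2) by (simp_all add: m_assoc)
  have e: "(c \<otimes> x) \<otimes> s = (d \<otimes> y) \<otimes> t" using cd(2,3) x(5) y(5) cR by (simp add: m_assoc)
  have m: "(c \<otimes> x) \<otimes> s \<in> S"
    using S.m_closed[OF cd(1) x(8)] x(5) cR by (simp add: m_assoc)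
  have "frac (a \<otimes> s) (a \<otimes> r \<oplus> b \<otimes> q) =
      frac ((c \<otimes> x) \<otimes> s) ((c \<otimes> x) \<otimes> r \<oplus> (d \<otimes> y) \<otimes> q)"
    by (rule frac_add_unique[OF x(1,2) y(1,2) ab _ _ e m]) (use cR cd(2) x(5) y(5) in auto)
  also have "\<dots> = frac (a' \<otimes> s') (a' \<otimes> r' \<oplus> b' \<otimes> q')"
    unfolding x' y'(2)
    by (rule frac_add_unique[OF x(3,4) y(3,4) ab' , symmetric])
      (use cR cd(2) x(6) y(6) e m in \<open>simp_all add: x' y'\<close>)
  finally show ?thesis .
qed

lemma frac_add:
  assumes "s \<in> S" "r \<in> carrier R" "t \<in> S" "q \<in> carrier R"
    "a \<in> carrier R" "b \<in> carrier R" "a \<otimes> s = b \<otimes> t" "a \<otimes> s \<in> S"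
  shows "frac s r \<oplus>\<^bsub>Loc\<^esub> frac t q = frac (a \<otimes> s) (a \<otimes> r \<oplus> b \<otimes> q)"
proof -
  have "left_frac_add R S (frac s r) (frac t q) = frac (a \<otimes> s) (a \<otimes> r \<oplus> b \<otimes> q)"
  proof (intro equalityI subsetI)
    fix z assume "z \<in> left_frac_add R S (frac s r) (frac t q)"
    then obtain s' r' t' q' a' b' where *:
      "(s', r') \<in> frac s r" "(t', q') \<in> frac t q" "a' \<in> carrier R" "b' \<in> carrier R"
      "a' \<otimes> s' = b' \<otimes> t'" "a' \<otimes> s' \<in> S" "z \<in> frac (a' \<otimes> s') (a' \<otimes> r' \<oplus> b' \<otimes> q')"
      unfolding left_frac_add_def by blast
    show "z \<in> frac (a \<otimes> s) (a \<otimes> r \<oplus> b \<otimes> q)"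
      using frac_add_cong[OF *(1,2)[unfolded mem_frac_iff] assms(5-8) *(3-6)] *(7) by simp
  next
    fix z assume "z \<in> frac (a \<otimes> s) (a \<otimes> r \<oplus> b \<otimes> q)"
    then show "z \<in> left_frac_add R S (frac s r) (frac t q)"
      unfolding left_frac_add_def
      using frac_self[OF assms(1,2)] frac_self[OF assms(3,4)] assms(5-8) by blast
  qed
  then show ?thesis by (simp add: left_localization_def)
qed

section \<open>The multiplicative monoid of the localization\<close>

lemma carrier_Loc: "carrier Loc = {frac s r | s r. s \<in> S \<and> r \<in> carrier R}"
  by (simp add: left_localization_def)

lemma one_Loc: "\<one>\<^bsub>Loc\<^esub> = frac \<one> \<one>"
  by (simp add: left_localization_def)

lemma frac_closed: "s \<in> S \<Longrightarrow> r \<in> carrier R \<Longrightarrow> frac s r \<in> carrier Loc"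
  unfolding carrier_Loc by blast

lemma frac_mult_frac_one:
  assumes "s \<in> S" "r \<in> carrier R" "q \<in> carrier R"
  shows "frac s r \<otimes>\<^bsub>Loc\<^esub> frac \<one> q = frac s (r \<otimes> q)"
  using frac_mult[of s r \<one> q \<one> r] assms by simp

lemma frac_one_mult_frac:
  assumes "s \<in> S" "r \<in> carrier R"
  shows "frac \<one> s \<otimes>\<^bsub>Loc\<^esub> frac s r = frac \<one> r"
  using frac_mult[of \<one> s s r \<one> \<one>] assms by simp

lemma frac_self_eq_one: "s \<in> S \<Longrightarrow> frac s s = \<one>\<^bsub>Loc\<^esub>"
  unfolding one_Loc by (rule frac_eqI[of _ _ _ _ \<one> s]) auto

lemma monoid_Loc: "monoid Loc"
proof
  show one: "\<one>\<^bsub>Loc\<^esub> \<in> carrier Loc" unfolding one_Loc by (intro frac_closed) auto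
  fix x assume "x \<in> carrier Loc"
  then obtain s r where x: "x = frac s r" "s \<in> S" "r \<in> carrier R" unfolding carrier_Loc by blast
  show "\<one>\<^bsub>Loc\<^esub> \<otimes>\<^bsub>Loc\<^esub> x = x"
    unfolding one_Loc x(1) using frac_mult[of \<one> \<one> s r s \<one>] x by simp
  show "x \<otimes>\<^bsub>Loc\<^esub> \<one>\<^bsub>Loc\<^esub> = x"
    unfolding one_Loc x(1) using frac_mult_frac_one x by simp
  fix y assume "y \<in> carrier Loc"
  then obtain t q where y: "y = frac t q" "t \<in> S" "q \<in> carrier R" unfolding carrier_Loc by blast
  show "x \<otimes>\<^bsub>Loc\<^esub> y \<in> carrier Loc"
  proof -
    from Den_l_Ore[OF Den x(3) y(2)] obtain a b
      where "a \<in> S" "b \<in> carrier R" "a \<otimes> r = b \<otimes> t" .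
    then show ?thesis
      unfolding x(1) y(1) using frac_mult[of s r t q a b] frac_closed x y by simp
  qed
  fix z assume "z \<in> carrier Loc"
  then obtain u p where z: "z = frac u p" "u \<in> S" "p \<in> carrier R" unfolding carrier_Loc by blast
  \<comment> \<open>The pair \<open>e\<close>, \<open>f\<close> computes the product of
    \<open>y\<close> and \<open>z\<close>, and \<open>g\<close>, \<open>h\<close> the product of
    \<open>x\<close> with it. For the other bracketing, \<open>h \<otimes> e\<close> computes the
    product of \<open>x\<close> and \<open>y\<close>, and \<open>h \<otimes> f\<close> with
    auxiliary factor one its product with \<open>z\<close>, so both sides end in the same
    fraction.\<close>
  from Den_l_Ore[OF Den y(3) z(2)] obtain e f
    where ef: "e \<in> S" "f \<in> carrier R" "e \<otimes> q = f \<otimes> u" .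
  have "e \<otimes> t \<in> S" using ef y by simp
  from Den_l_Ore[OF Den x(3) this] obtain g h
    where gh: "g \<in> S" "h \<in> carrier R" "g \<otimes> r = h \<otimes> (e \<otimes> t)" .
  have eR: "e \<in> carrier R" "t \<in> carrier R" "u \<in> carrier R" using ef(1) y(2) z(2) by auto
  have 1: "g \<otimes> r = (h \<otimes> e) \<otimes> t" using gh(2,3) eR by (simp add: m_assoc)
  have 2: "\<one> \<otimes> ((h \<otimes> e) \<otimes> q) = (h \<otimes> f) \<otimes> u"
  proof -
    have "\<one> \<otimes> ((h \<otimes> e) \<otimes> q) = h \<otimes> (e \<otimes> q)" using gh(2) eR y(3) by (simp add: m_assoc)
    then show ?thesis unfolding ef(3) using gh(2) ef(2) eR by (simp add: m_assoc)
  qed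
  have "(x \<otimes>\<^bsub>Loc\<^esub> y) \<otimes>\<^bsub>Loc\<^esub> z = frac (g \<otimes> s) ((h \<otimes> e) \<otimes> q) \<otimes>\<^bsub>Loc\<^esub> frac u p"
    unfolding x(1) y(1) z(1) using frac_mult[OF x(2,3) y(2,3) gh(1) _ 1] gh(2) eR by simp
  also have "\<dots> = frac (\<one> \<otimes> (g \<otimes> s)) ((h \<otimes> f) \<otimes> p)"
    by (rule frac_mult[OF _ _ z(2,3) _ _ 2]) (use gh(1,2) x(2) ef(2) eR y(3) in auto)
  also have "\<dots> = frac (g \<otimes> s) (h \<otimes> (f \<otimes> p))"
    using gh(1,2) x(2) ef(2) z(3) by (simp add: m_assoc)
  also have "\<dots> = frac s r \<otimes>\<^bsub>Loc\<^esub> frac (e \<otimes> t) (f \<otimes> p)"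
    by (rule frac_mult[OF x(2,3) _ _ gh, symmetric]) (use ef(1,2) y(2) z(3) in auto)
  also have "\<dots> = x \<otimes>\<^bsub>Loc\<^esub> (y \<otimes>\<^bsub>Loc\<^esub> z)"
    unfolding x(1) y(1) z(1) frac_mult[OF y(2,3) z(2,3) ef] ..
  finally show "(x \<otimes>\<^bsub>Loc\<^esub> y) \<otimes>\<^bsub>Loc\<^esub> z = x \<otimes>\<^bsub>Loc\<^esub> (y \<otimes>\<^bsub>Loc\<^esub> z)" .
qed

sublocale Loc: monoid Loc
  by (rule monoid_Loc)

section \<open>Elements of the ring that become units in the localization\<close>

lemma frac_Units:
  assumes "s \<in> S" "t \<in> S"
  shows "frac s t \<in> Units Loc"
proof -
  have "frac s t \<otimes>\<^bsub>Loc\<^esub> frac t s = frac s s" if "s \<in> S" "t \<in> S" for s t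
    using frac_mult[of s t t s \<one> \<one>] that by simp
  then have "frac s t \<otimes>\<^bsub>Loc\<^esub> frac t s = \<one>\<^bsub>Loc\<^esub>" "frac t s \<otimes>\<^bsub>Loc\<^esub> frac s t = \<one>\<^bsub>Loc\<^esub>"
    using assms frac_self_eq_one by auto
  then show ?thesis unfolding Units_def using frac_closed assms by auto
qed

text \<open>For \<open>S = T_l R\<close> this is the preimage of the units under
  \<open>\<sigma>\<close>. It turns out to be a left denominator set with the same
  \<open>ass\<close> as \<open>S\<close>, so it equals \<open>S\<close> as soon as \<open>S\<close>
  is largest.\<close>

definition unit_numerators :: "'a set" where
  "unit_numerators = {r \<in> carrier R. frac \<one> r \<in> Units Loc}"

lemma frac_one_zero_iff:
  assumes "r \<in> carrier R"
  shows "frac \<one> r = frac \<one> \<zero> \<longleftrightarrow> r \<in> ass R S"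
proof -
  have "(\<exists>s\<in>S. s \<otimes> r = s \<otimes> \<zero>) \<longleftrightarrow> (\<exists>s\<in>S. s \<otimes> r = \<zero>)" by (intro bex_cong) auto
  then show ?thesis using frac_one_eq_iff[OF assms zero_closed] assms by (simp add: in_ass_iff)
qed

text \<open>An element of \<open>R\<close> lies in \<open>ass R S\<close> exactly when its fraction
  over one vanishes, and units of the localization cancel on either side.\<close>

lemma unit_numerators_absorb:
  assumes u: "u \<in> unit_numerators" and r: "r \<in> carrier R"
  shows "u \<otimes> r \<in> ass R S \<Longrightarrow> r \<in> ass R S" and "r \<otimes> u \<in> ass R S \<Longrightarrow> r \<in> ass R S"
proof -
  have uR: "u \<in> carrier R" and U: "frac \<one> u \<in> Units Loc" using u by (auto simp: unit_numerators_def)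
  have rL: "frac \<one> r \<in> carrier Loc" and zL: "frac \<one> \<zero> \<in> carrier Loc" using r frac_closed by auto
  have uL: "frac \<one> u \<in> carrier Loc" using U by auto
  {
    assume "u \<otimes> r \<in> ass R S"
    then have "frac \<one> u \<otimes>\<^bsub>Loc\<^esub> frac \<one> r = frac \<one> \<zero>"
      using frac_mult_frac_one[of \<one> u r] frac_one_zero_iff uR r by simp
    \<comment> \<open>Zero is rewritten as a product with the unit, so that cancellation in the
      monoid applies.\<close>
    also have "\<dots> = frac \<one> u \<otimes>\<^bsub>Loc\<^esub> frac \<one> \<zero>"
      using frac_mult_frac_one[of \<one> u \<zero>] uR by simp
    finally have "frac \<one> r = frac \<one> \<zero>" using Loc.Units_l_cancel U rL zL by simp
    then show "r \<in> ass R S" using frac_one_zero_iff r by simp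
  next
    assume "r \<otimes> u \<in> ass R S"
    then have "frac \<one> r \<otimes>\<^bsub>Loc\<^esub> frac \<one> u = frac \<one> \<zero>"
      using frac_mult_frac_one[of \<one> r u] frac_one_zero_iff uR r by simp
    also have "\<dots> = frac \<one> \<zero> \<otimes>\<^bsub>Loc\<^esub> frac \<one> u"
      using frac_mult_frac_one[of \<one> \<zero> u] uR by simp
    finally have "frac \<one> r \<otimes>\<^bsub>Loc\<^esub> frac \<one> u \<otimes>\<^bsub>Loc\<^esub> inv\<^bsub>Loc\<^esub> frac \<one> u
        = frac \<one> \<zero> \<otimes>\<^bsub>Loc\<^esub> frac \<one> u \<otimes>\<^bsub>Loc\<^esub> inv\<^bsub>Loc\<^esub> frac \<one> u" by simp
    then have "frac \<one> r = frac \<one> \<zero>" using U rL zL uL by (simp add: Loc.m_assoc)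
    then show "r \<in> ass R S" using frac_one_zero_iff r by simp
  }
qed

lemma subset_unit_numerators: "S \<subseteq> unit_numerators"
  using frac_Units by (auto simp: unit_numerators_def)

lemma unit_numerators_Den_l: "unit_numerators \<in> Den_l R"
proof (rule Den_lI)
  show "submonoid unit_numerators R"
  proof
    show "unit_numerators \<subseteq> carrier R" by (auto simp: unit_numerators_def)
    show "\<one> \<in> unit_numerators" using subset_unit_numerators S.one_closed by blast
    fix x y assume "x \<in> unit_numerators" "y \<in> unit_numerators"
    then show "x \<otimes> y \<in> unit_numerators"
      using Loc.Units_m_closed[of "frac \<one> x" "frac \<one> y"] frac_mult_frac_one[of \<one> x y]
      by (auto simp: unit_numerators_def)
  qed
  show "\<zero> \<notin> unit_numerators"
  proof
    assume "\<zero> \<in> unit_numerators"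
    from unit_numerators_absorb(1)[OF this one_closed] show False
      using zero_in_ass[OF Den] one_notin_ass[OF Den] by simp
  qed
next
  fix r u assume r: "r \<in> carrier R" and u: "u \<in> unit_numerators"
  have uR: "u \<in> carrier R" and U: "frac \<one> u \<in> Units Loc" using u by (auto simp: unit_numerators_def)
  have rL: "frac \<one> r \<in> carrier Loc" and uL: "frac \<one> u \<in> carrier Loc" using r U frac_closed by auto
  \<comment> \<open>The Ore condition for \<open>u\<close> is found in the localization: write
    \<open>r u^-1\<close> as \<open>s^-1 q\<close>, so that \<open>r\<close> and
    \<open>s^-1 (q u)\<close> are the same fraction, and clear denominators.\<close>
  have "frac \<one> r \<otimes>\<^bsub>Loc\<^esub> inv\<^bsub>Loc\<^esub> frac \<one> u \<in> carrier Loc" using rL U by simp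
  then obtain s q where sq: "frac \<one> r \<otimes>\<^bsub>Loc\<^esub> inv\<^bsub>Loc\<^esub> frac \<one> u = frac s q" "s \<in> S" "q \<in> carrier R"
    unfolding carrier_Loc by blast
  have "frac \<one> r = frac \<one> r \<otimes>\<^bsub>Loc\<^esub> inv\<^bsub>Loc\<^esub> frac \<one> u \<otimes>\<^bsub>Loc\<^esub> frac \<one> u"
    using rL uL U by (simp add: Loc.m_assoc)
  also have "\<dots> = frac s (q \<otimes> u)" unfolding sq(1) using frac_mult_frac_one sq uR by simp
  finally have "((\<one>, r), (s, q \<otimes> u)) \<in> left_frac_rel R S"
    using frac_eq_iff_rel[of \<one> r s "q \<otimes> u"] r sq uR by simp
  \<comment> \<open>The first fraction has denominator one, so the common denominator is
    \<open>a\<close> itself, which therefore lies in \<open>S\<close>.\<close>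
  then obtain a b where ab: "a \<in> carrier R" "b \<in> carrier R" "a \<otimes> \<one> \<in> S" "a \<otimes> r = b \<otimes> (q \<otimes> u)"
    by (rule left_frac_relE)
  then have "a \<in> unit_numerators" "a \<otimes> r = (b \<otimes> q) \<otimes> u"
    using subset_unit_numerators sq uR by (auto simp: m_assoc)
  then show "\<exists>s'\<in>unit_numerators. \<exists>r'\<in>carrier R. s' \<otimes> r = r' \<otimes> u" using ab sq by blast
next
  fix r u assume r: "r \<in> carrier R" and u: "u \<in> unit_numerators" and "r \<otimes> u = \<zero>"
  then have "r \<in> ass R S" using unit_numerators_absorb(2)[OF u r] zero_in_ass[OF Den] by simp
  then show "\<exists>s'\<in>unit_numerators. s' \<otimes> r = \<zero>"
    unfolding in_ass_iff using subset_unit_numerators by blast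
qed

lemma ass_unit_numerators: "ass R unit_numerators = ass R S"
proof
  show "ass R unit_numerators \<subseteq> ass R S"
  proof
    fix r assume "r \<in> ass R unit_numerators"
    then obtain u where u: "u \<in> unit_numerators" "u \<otimes> r = \<zero>" and r: "r \<in> carrier R"
      unfolding in_ass_iff by blast
    then show "r \<in> ass R S" using unit_numerators_absorb(1)[OF u(1) r] zero_in_ass[OF Den] by simp
  qed
  show "ass R S \<subseteq> ass R unit_numerators" by (rule ass_mono[OF subset_unit_numerators])
qed

text \<open>Multiplying a unit \<open>frac s r\<close> by the unit \<open>frac \<one> s\<close>
  leaves \<open>frac \<one> r\<close>, so \<open>r\<close> is a unit numerator.\<close>

lemma Units_Loc_saturated:
  assumes "unit_numerators = S"
  shows "Units Loc = {frac s t | s t. s \<in> S \<and> t \<in> S}"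
proof
  show "{frac s t | s t. s \<in> S \<and> t \<in> S} \<subseteq> Units Loc" using frac_Units by blast
  show "Units Loc \<subseteq> {frac s t | s t. s \<in> S \<and> t \<in> S}"
  proof
    fix x assume x: "x \<in> Units Loc"
    then have "x \<in> carrier Loc" by (rule Loc.Units_closed)
    then obtain s r where sr: "x = frac s r" "s \<in> S" "r \<in> carrier R" unfolding carrier_Loc by blast
    have "frac \<one> s \<otimes>\<^bsub>Loc\<^esub> x \<in> Units Loc" using x sr frac_Units by simp
    then have "r \<in> unit_numerators"
      unfolding unit_numerators_def sr(1) using frac_one_mult_frac sr by simp
    then show "x \<in> {frac s t | s t. s \<in> S \<and> t \<in> S}" using sr unfolding assms by blast
  qed
qed

end

section \<open>Reduction modulo \<open>ass S\<close>\<close>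

context left_denominator_set
begin

abbreviation Quo :: "'a set ring" where
  "Quo \<equiv> R Quot ass R S"

abbreviation pr :: "'a \<Rightarrow> 'a set" where
  "pr r \<equiv> ass R S +> r"

sublocale ass: ideal "ass R S" R
  using Den by (rule ass_ideal)

sublocale Quo: ring Quo
  by (rule ass.quotient_is_ring)

lemma pr_closed: "r \<in> carrier R \<Longrightarrow> pr r \<in> carrier Quo"
  using ass.rcos_ring_hom by (rule ring_hom_closed)

lemma pr_mult: "r \<in> carrier R \<Longrightarrow> q \<in> carrier R \<Longrightarrow> pr (r \<otimes> q) = pr r \<otimes>\<^bsub>Quo\<^esub> pr q"
  using ass.rcos_ring_hom by (rule ring_hom_mult)

lemma pr_add: "r \<in> carrier R \<Longrightarrow> q \<in> carrier R \<Longrightarrow> pr (r \<oplus> q) = pr r \<oplus>\<^bsub>Quo\<^esub> pr q"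
  using ass.rcos_ring_hom by (rule ring_hom_add)

lemma pr_one: "pr \<one> = \<one>\<^bsub>Quo\<^esub>"
  using ass.rcos_ring_hom by (rule ring_hom_one)

lemma pr_surj:
  assumes "x \<in> carrier Quo"
  obtains r where "r \<in> carrier R" "x = pr r"
  using assms unfolding FactRing_simps by auto

text \<open>Equations in the quotient are lifted through this form: \<open>s\<close> is an
  annihilator of the difference \<open>a \<ominus> b\<close>.\<close>

lemma pr_eq_iff:
  assumes "a \<in> carrier R" "b \<in> carrier R"
  shows "pr a = pr b \<longleftrightarrow> (\<exists>s\<in>S. s \<otimes> a = s \<otimes> b)"
proof -
  have "s \<otimes> (a \<ominus> b) = \<zero> \<longleftrightarrow> s \<otimes> a = s \<otimes> b" if s: "s \<in> S" for s
  proof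
    assume "s \<otimes> (a \<ominus> b) = \<zero>"
    then have "s \<otimes> a \<oplus> \<ominus> (s \<otimes> b) = \<zero>" using assms s by (simp add: minus_eq r_distr r_minus)
    then have "\<ominus> (\<ominus> (s \<otimes> b)) = s \<otimes> a" using assms s by (intro minus_equality) auto
    then show "s \<otimes> a = s \<otimes> b" using assms s by simp
  next
    assume "s \<otimes> a = s \<otimes> b"
    then show "s \<otimes> (a \<ominus> b) = \<zero>" using assms s by (simp add: minus_eq r_distr r_minus r_neg)
  qed
  then have "a \<ominus> b \<in> ass R S \<longleftrightarrow> (\<exists>s\<in>S. s \<otimes> a = s \<otimes> b)"
    using assms unfolding in_ass_iff by (simp add: minus_closed cong: bex_cong)
  then show ?thesis using quotient_eq_iff_same_a_r_cos[OF ass.ideal_axioms assms] by simp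
qed

lemma pr_zero_iff: "r \<in> carrier R \<Longrightarrow> pr r = \<zero>\<^bsub>Quo\<^esub> \<longleftrightarrow> r \<in> ass R S"
  using ass.rcos_const_imp_mem[of r] ass.a_rcos_const[of r] by (auto simp: FactRing_def)

lemma ass_Quo_eq_zeroI:
  assumes "ass Quo X \<subseteq> {\<zero>\<^bsub>Quo\<^esub>}" "\<one>\<^bsub>Quo\<^esub> \<in> X"
  shows "ass Quo X = {\<zero>\<^bsub>Quo\<^esub>}"
proof -
  have "\<zero>\<^bsub>Quo\<^esub> \<in> ass Quo X"
    unfolding Quo.in_ass_iff using assms(2) by (auto intro!: bexI[of _ "\<one>\<^bsub>Quo\<^esub>"])
  then show ?thesis using assms(1) by blast
qed

text \<open>A product vanishing in the quotient lifts to a product in \<open>ass R S\<close>, and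
  elements of \<open>S\<close> cancel there on both sides, by \<open>mult_in_ass_cancel\<close> and
  by \<open>Den_l_absorb_right\<close> with \<open>M = S\<close>. So the image of \<open>S\<close>
  consists of regular elements.\<close>

lemma image_Den_l: "pr ` S \<in> Den_l Quo"
  and ass_image: "ass Quo (pr ` S) = {\<zero>\<^bsub>Quo\<^esub>}"
proof -
  show "pr ` S \<in> Den_l Quo"
  proof (rule Quo.Den_lI)
    show "submonoid (pr ` S) Quo"
    proof
      show "pr ` S \<subseteq> carrier Quo" using pr_closed by auto
      show "\<one>\<^bsub>Quo\<^esub> \<in> pr ` S" using pr_one S.one_closed by (metis imageI)
      fix x y assume "x \<in> pr ` S" "y \<in> pr ` S"
      then show "x \<otimes>\<^bsub>Quo\<^esub> y \<in> pr ` S" by (auto simp: pr_mult[symmetric])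
    qed
    show "\<zero>\<^bsub>Quo\<^esub> \<notin> pr ` S"
    proof
      assume "\<zero>\<^bsub>Quo\<^esub> \<in> pr ` S"
      then obtain s where s: "s \<in> S" "pr s = \<zero>\<^bsub>Quo\<^esub>" by (metis imageE)
      then have "s \<otimes> \<one> \<in> ass R S" using pr_zero_iff by simp
      from mult_in_ass_cancel[OF Den s(1) one_closed this] show False
        using one_notin_ass[OF Den] by blast
    qed
  next
    fix x y assume "x \<in> carrier Quo" and "y \<in> pr ` S"
    then obtain r s where x: "x = pr r" "r \<in> carrier R" and y: "y = pr s" "s \<in> S"
      by (auto elim!: pr_surj)
    from Den_l_Ore[OF Den x(2) y(2)] obtain s' r'
      where e: "s' \<in> S" "r' \<in> carrier R" "s' \<otimes> r = r' \<otimes> s" .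
    then have "pr s' \<otimes>\<^bsub>Quo\<^esub> x = pr r' \<otimes>\<^bsub>Quo\<^esub> y" using x y by (simp add: pr_mult[symmetric])
    then show "\<exists>s'\<in>pr ` S. \<exists>r'\<in>carrier Quo. s' \<otimes>\<^bsub>Quo\<^esub> x = r' \<otimes>\<^bsub>Quo\<^esub> y"
      using e(1,2) pr_closed by blast
    assume "x \<otimes>\<^bsub>Quo\<^esub> y = \<zero>\<^bsub>Quo\<^esub>"
    then have "pr (r \<otimes> s) = \<zero>\<^bsub>Quo\<^esub>" using x y by (simp add: pr_mult)
    then have "r \<otimes> s \<in> ass R S" using x y by (simp add: pr_zero_iff)
    then have "r \<in> ass R S" using Den_l_absorb_right[OF Den Den _ y(2) x(2)] by simp
    then have "\<one>\<^bsub>Quo\<^esub> \<otimes>\<^bsub>Quo\<^esub> x = \<zero>\<^bsub>Quo\<^esub>" using x pr_zero_iff pr_closed by simp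
    then show "\<exists>s'\<in>pr ` S. s' \<otimes>\<^bsub>Quo\<^esub> x = \<zero>\<^bsub>Quo\<^esub>"
      unfolding pr_one[symmetric] using S.one_closed by blast
  qed
  show "ass Quo (pr ` S) = {\<zero>\<^bsub>Quo\<^esub>}"
  proof (rule ass_Quo_eq_zeroI)
    show "ass Quo (pr ` S) \<subseteq> {\<zero>\<^bsub>Quo\<^esub>}"
    proof
      fix x assume "x \<in> ass Quo (pr ` S)"
      then obtain s where s: "s \<in> S" "pr s \<otimes>\<^bsub>Quo\<^esub> x = \<zero>\<^bsub>Quo\<^esub>" and "x \<in> carrier Quo"
        unfolding Quo.in_ass_iff by blast
      then obtain r where x: "x = pr r" "r \<in> carrier R" by (auto elim: pr_surj)
      then have "s \<otimes> r \<in> ass R S" using s pr_zero_iff[of "s \<otimes> r"] by (simp add: pr_mult)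
      then have "r \<in> ass R S" by (rule mult_in_ass_cancel[OF Den s(1) x(2)])
      then show "x \<in> {\<zero>\<^bsub>Quo\<^esub>}" using x pr_zero_iff by simp
    qed
    show "\<one>\<^bsub>Quo\<^esub> \<in> pr ` S" using pr_one S.one_closed by (metis imageI)
  qed
qed

text \<open>Ore equations for \<open>X\<close> lift to \<open>R\<close> up to a left factor from
  \<open>S\<close>, and this factor is absorbed because \<open>S \<subseteq> Y\<close>. Since
  \<open>ass Quo X\<close> is zero, an element of \<open>R\<close> killed by \<open>Y\<close> is
  zero in the quotient, hence in \<open>ass R S\<close>.\<close>

lemma vimage_Den_l:
  assumes X: "X \<in> Den_l Quo" and ass_X: "ass Quo X = {\<zero>\<^bsub>Quo\<^esub>}" and sub: "pr ` S \<subseteq> X"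
  defines "Y \<equiv> {r \<in> carrier R. pr r \<in> X}"
  shows "Y \<in> Den_l R" and "ass R Y = ass R S"
proof -
  interpret X: submonoid X Quo using X by (rule Quo.Den_l_submonoid)
  have SY: "S \<subseteq> Y" using sub by (auto simp: Y_def)
  have absorb: "r \<in> ass R S" if "x \<in> X" "x \<otimes>\<^bsub>Quo\<^esub> pr r = \<zero>\<^bsub>Quo\<^esub>" "r \<in> carrier R" for x r
  proof -
    have "pr r \<in> ass Quo X" unfolding Quo.in_ass_iff using that pr_closed by blast
    then show ?thesis using ass_X pr_zero_iff that by simp
  qed
  show "Y \<in> Den_l R"
  proof (rule Den_lI)
    show "submonoid Y R"
    proof
      show "Y \<subseteq> carrier R" by (auto simp: Y_def)
      show "\<one> \<in> Y" using pr_one X.one_closed by (simp add: Y_def)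
      fix x y assume "x \<in> Y" "y \<in> Y"
      then show "x \<otimes> y \<in> Y" using X.m_closed by (simp add: Y_def pr_mult)
    qed
    have "pr \<zero> = \<zero>\<^bsub>Quo\<^esub>" using pr_zero_iff zero_in_ass[OF Den] by simp
    then show "\<zero> \<notin> Y" using Quo.Den_l_zero[OF X] by (simp add: Y_def)
  next
    fix r y assume r: "r \<in> carrier R" and "y \<in> Y"
    then have y: "y \<in> carrier R" "pr y \<in> X" by (auto simp: Y_def)
    from Quo.Den_l_Ore[OF X pr_closed[OF r] y(2)] obtain x' z'
      where e: "x' \<in> X" "z' \<in> carrier Quo" "x' \<otimes>\<^bsub>Quo\<^esub> pr r = z' \<otimes>\<^bsub>Quo\<^esub> pr y" .
    obtain y' where y': "y' \<in> carrier R" "x' = pr y'" using e(1) X.mem_carrier by (blast elim: pr_surj)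
    obtain r' where r': "r' \<in> carrier R" "z' = pr r'" using e(2) by (rule pr_surj)
    have "pr (y' \<otimes> r) = pr (r' \<otimes> y)" using e(3) y' r' r y by (simp add: pr_mult)
    then obtain s where s: "s \<in> S" "s \<otimes> (y' \<otimes> r) = s \<otimes> (r' \<otimes> y)"
      using pr_eq_iff y' r' r y by auto
    then have "(s \<otimes> y') \<otimes> r = (s \<otimes> r') \<otimes> y" using y' r' r y by (simp add: m_assoc)
    moreover have "s \<otimes> y' \<in> Y"
      using X.m_closed[of "pr s" "pr y'"] sub s(1) y' e(1) by (auto simp: Y_def pr_mult)
    moreover have "s \<otimes> r' \<in> carrier R" using s r' by simp
    ultimately show "\<exists>s'\<in>Y. \<exists>r'\<in>carrier R. s' \<otimes> r = r' \<otimes> y" by blast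
    assume "r \<otimes> y = \<zero>"
    then have "pr r \<otimes>\<^bsub>Quo\<^esub> pr y = \<zero>\<^bsub>Quo\<^esub>"
      using pr_zero_iff[of \<zero>] zero_in_ass[OF Den] r y by (simp add: pr_mult[symmetric])
    then have "pr r \<in> ass Quo X" using Quo.Den_l_ass[OF X pr_closed[OF r] y(2)] by simp
    then have "r \<in> ass R S" using ass_X pr_zero_iff r by simp
    then show "\<exists>s'\<in>Y. s' \<otimes> r = \<zero>" using SY unfolding in_ass_iff by blast
  qed
  have "ass R Y \<subseteq> ass R S"
  proof
    fix r assume "r \<in> ass R Y"
    then obtain y where y: "y \<in> Y" "y \<otimes> r = \<zero>" and r: "r \<in> carrier R"
      unfolding in_ass_iff by blast
    then have "pr y \<otimes>\<^bsub>Quo\<^esub> pr r = \<zero>\<^bsub>Quo\<^esub>"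
      using pr_zero_iff[of \<zero>] zero_in_ass[OF Den] by (simp add: pr_mult[symmetric] Y_def)
    then show "r \<in> ass R S" using absorb[of "pr y" r] y(1) r by (simp add: Y_def)
  qed
  then show "ass R Y = ass R S" using ass_mono[OF SY] by blast
qed

end

section \<open>Left denominator sets that are largest for their \<open>ass\<close>\<close>

locale saturated_denominator_set = left_denominator_set +
  assumes saturated: "S = S_l R (ass R S)"
begin

lemma saturated_upper: "T \<in> Den_l R \<Longrightarrow> ass R T = ass R S \<Longrightarrow> T \<subseteq> S"
  using S_l_upper[OF Den, of T] saturated by simp

lemma unit_numerators_eq: "unit_numerators = S"
  using saturated_upper[OF unit_numerators_Den_l ass_unit_numerators] subset_unit_numerators
  by (rule antisym)

text \<open>The largest regular set of the quotient contains the image of \<open>S\<close>, so its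
  preimage is a left denominator set with the same \<open>ass\<close> as \<open>S\<close> and lies
  in \<open>S\<close>. Surjectivity of \<open>pr\<close> turns this statement on preimages into one
  on images.\<close>

lemma S_l_Quo:
  shows vimage_S_l_Quo: "{r \<in> carrier R. pr r \<in> S_l Quo {\<zero>\<^bsub>Quo\<^esub>}} = S"
    and S_l_Quo_eq_image: "S_l Quo {\<zero>\<^bsub>Quo\<^esub>} = pr ` S"
proof -
  \<comment> \<open>The image of \<open>S\<close> witnesses that the zero ideal of the quotient is
    an \<open>ass\<close>, so the largest set exists there.\<close>
  note X = Quo.S_l_greatest[OF image_Den_l, unfolded ass_image]
  have sub: "pr ` S \<subseteq> S_l Quo {\<zero>\<^bsub>Quo\<^esub>}" by (rule X(3)[OF image_Den_l ass_image])
  show *: "{r \<in> carrier R. pr r \<in> S_l Quo {\<zero>\<^bsub>Quo\<^esub>}} = S"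
  proof
    show "{r \<in> carrier R. pr r \<in> S_l Quo {\<zero>\<^bsub>Quo\<^esub>}} \<subseteq> S"
      by (rule saturated_upper; rule vimage_Den_l[OF X(1,2) sub])
    show "S \<subseteq> {r \<in> carrier R. pr r \<in> S_l Quo {\<zero>\<^bsub>Quo\<^esub>}}" using sub by auto
  qed
  have "S_l Quo {\<zero>\<^bsub>Quo\<^esub>} \<subseteq> pr ` S"
  proof
    fix x assume x: "x \<in> S_l Quo {\<zero>\<^bsub>Quo\<^esub>}"
    then have "x \<in> carrier Quo" using submonoid.mem_carrier[OF Quo.Den_l_submonoid[OF X(1)]] by simp
    then obtain r where "r \<in> carrier R" "x = pr r" by (rule pr_surj)
    then show "x \<in> pr ` S" using x * by blast
  qed
  then show "S_l Quo {\<zero>\<^bsub>Quo\<^esub>} = pr ` S" using sub by (rule antisym)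
qed

text \<open>By \<open>S_l_Quo_eq_image\<close>, the ring \<open>QL.Loc\<close> is \<open>Q_l\<close>
  of the quotient.\<close>

sublocale QL: left_denominator_set Quo "pr ` S"
  by unfold_locales (rule image_Den_l)

lemma pr_mem_image_iff: "r \<in> carrier R \<Longrightarrow> pr r \<in> pr ` S \<longleftrightarrow> r \<in> S"
  using S_l_Quo by blast

text \<open>From the quotient back to \<open>R\<close>, the denominator equation lifts after
  multiplication by \<open>g\<close> and the numerator equation after a further \<open>h\<close>.
  The expanded denominator \<open>a \<otimes> s\<close> lies in \<open>S\<close> itself because
  membership in \<open>S\<close> can be tested modulo \<open>ass R S\<close>.\<close>

lemma left_frac_rel_pr_iff:
  assumes c: "s \<in> S" "r \<in> carrier R" "t \<in> S" "q \<in> carrier R"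
  shows "((pr s, pr r), (pr t, pr q)) \<in> left_frac_rel Quo (pr ` S) \<longleftrightarrow>
    ((s, r), (t, q)) \<in> left_frac_rel R S"
proof
  assume "((s, r), (t, q)) \<in> left_frac_rel R S"
  then obtain a b where ab: "a \<in> carrier R" "b \<in> carrier R"
    "a \<otimes> s = b \<otimes> t" "a \<otimes> s \<in> S" "a \<otimes> r = b \<otimes> q" by (rule left_frac_relE)
  show "((pr s, pr r), (pr t, pr q)) \<in> left_frac_rel Quo (pr ` S)"
    by (rule QL.left_frac_relI[of _ _ _ _ "pr a" "pr b"])
      (use c ab pr_closed in \<open>simp_all add: pr_mult[symmetric]\<close>)
next
  assume "((pr s, pr r), (pr t, pr q)) \<in> left_frac_rel Quo (pr ` S)"
  then obtain a' b' where ab': "a' \<in> carrier Quo" "b' \<in> carrier Quo"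
    "a' \<otimes>\<^bsub>Quo\<^esub> pr s = b' \<otimes>\<^bsub>Quo\<^esub> pr t" "a' \<otimes>\<^bsub>Quo\<^esub> pr s \<in> pr ` S" "a' \<otimes>\<^bsub>Quo\<^esub> pr r = b' \<otimes>\<^bsub>Quo\<^esub> pr q"
    by (rule QL.left_frac_relE)
  obtain a where a: "a \<in> carrier R" "a' = pr a" using ab'(1) by (rule pr_surj)
  obtain b where b: "b \<in> carrier R" "b' = pr b" using ab'(2) by (rule pr_surj)
  have cR: "s \<in> carrier R" "t \<in> carrier R" using c by auto
  have "pr (a \<otimes> s) = pr (b \<otimes> t)" using ab'(3) a b cR by (simp add: pr_mult)
  then obtain g where g: "g \<in> S" "g \<otimes> (a \<otimes> s) = g \<otimes> (b \<otimes> t)"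
    using pr_eq_iff[of "a \<otimes> s" "b \<otimes> t"] a b cR by auto
  have gR: "g \<in> carrier R" using g(1) by simp
  have "pr (g \<otimes> (a \<otimes> r)) = pr (g \<otimes> (b \<otimes> q))" using ab'(5) a b c gR by (simp add: pr_mult)
  then obtain h where h: "h \<in> S" "h \<otimes> (g \<otimes> (a \<otimes> r)) = h \<otimes> (g \<otimes> (b \<otimes> q))"
    using pr_eq_iff[of "g \<otimes> (a \<otimes> r)" "g \<otimes> (b \<otimes> q)"] a b c gR by auto
  have hR: "h \<in> carrier R" using h(1) by simp
  have "pr (a \<otimes> s) \<in> pr ` S" using ab'(4) a cR by (simp add: pr_mult)
  then have "a \<otimes> s \<in> S" using pr_mem_image_iff a cR by simp
  show "((s, r), (t, q)) \<in> left_frac_rel R S"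
  proof (rule left_frac_relI)
    have e: "(h \<otimes> (g \<otimes> a)) \<otimes> s = h \<otimes> (g \<otimes> (a \<otimes> s))" using a gR hR cR by (simp add: m_assoc)
    then show "(h \<otimes> (g \<otimes> a)) \<otimes> s \<in> S" using \<open>a \<otimes> s \<in> S\<close> g(1) h(1) by simp
    show "(h \<otimes> (g \<otimes> a)) \<otimes> s = (h \<otimes> (g \<otimes> b)) \<otimes> t"
      unfolding e g(2) using b gR hR cR by (simp add: m_assoc)
    have "(h \<otimes> (g \<otimes> a)) \<otimes> r = h \<otimes> (g \<otimes> (a \<otimes> r))" using a gR hR c by (simp add: m_assoc)
    then show "(h \<otimes> (g \<otimes> a)) \<otimes> r = (h \<otimes> (g \<otimes> b)) \<otimes> q"
      unfolding h(2) using b gR hR c by (simp add: m_assoc)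
  qed (use a b c gR hR in auto)
qed

text \<open>
  Fractions are classes of pairs, so the canonical isomorphism
  \<open>S\<^sup>-\<^sup>1R \<simeq> \<pi>(S)\<^sup>-\<^sup>1(R / ass S)\<close> is just the image of a class under \<open>\<pi> \<times> \<pi>\<close>.
  That this image is a full class needs \<open>\<pi>\<^sup>-\<^sup>1(\<pi>(S)) = S\<close>.
\<close>

lemma image_frac:
  assumes c: "s \<in> S" "r \<in> carrier R"
  shows "map_prod pr pr ` frac s r = QL.frac (pr s) (pr r)"
proof (intro equalityI subsetI)
  fix x assume "x \<in> map_prod pr pr ` frac s r"
  then obtain t q where x: "x = (pr t, pr q)" and rel: "((s, r), (t, q)) \<in> left_frac_rel R S"
    by (auto simp: mem_frac_iff)
  then have "t \<in> S" "q \<in> carrier R" by (auto simp: left_frac_rel_iff)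
  then show "x \<in> QL.frac (pr s) (pr r)"
    unfolding x QL.mem_frac_iff using left_frac_rel_pr_iff c rel by simp
next
  fix x assume x: "x \<in> QL.frac (pr s) (pr r)"
  obtain y z where yz: "x = (y, z)" by (cases x)
  have rel: "((pr s, pr r), (y, z)) \<in> left_frac_rel Quo (pr ` S)"
    using x unfolding yz QL.mem_frac_iff .
  then have "y \<in> pr ` S" "z \<in> carrier Quo" by (auto simp: QL.left_frac_rel_iff)
  then obtain t q where tq: "y = pr t" "t \<in> S" "z = pr q" "q \<in> carrier R"
    by (auto elim!: pr_surj)
  then have "(t, q) \<in> frac s r"
    using rel left_frac_rel_pr_iff[OF c tq(2,4)] unfolding mem_frac_iff by simp
  then show "x \<in> map_prod pr pr ` frac s r" unfolding yz tq by (force intro: image_eqI)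
qed

lemma Loc_iso_Quo: "Loc \<simeq> QL.Loc"
proof -
  \<comment> \<open>Injectivity is the lifting direction of \<open>left_frac_rel_pr_iff\<close>;
    surjectivity comes from lifting numerators and denominators separately.\<close>
  have bij: "bij_betw ((`) (map_prod pr pr)) (carrier Loc) (carrier QL.Loc)"
    unfolding bij_betw_def
  proof
    show "inj_on ((`) (map_prod pr pr)) (carrier Loc)"
    proof (rule inj_onI)
      fix x y assume "x \<in> carrier Loc" "y \<in> carrier Loc"
        and eq: "map_prod pr pr ` x = map_prod pr pr ` y"
      then obtain s r t q where x: "x = frac s r" "s \<in> S" "r \<in> carrier R"
        and y: "y = frac t q" "t \<in> S" "q \<in> carrier R" unfolding carrier_Loc by blast
      have "QL.frac (pr s) (pr r) = QL.frac (pr t) (pr q)"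
        using eq image_frac x y by simp
      then show "x = y"
        unfolding x(1) y(1) frac_eq_iff_rel[OF x(2,3) y(2,3)]
        using QL.frac_eq_iff_rel left_frac_rel_pr_iff x y pr_closed by simp
    qed
    show "(`) (map_prod pr pr) ` carrier Loc = carrier QL.Loc"
    proof (intro equalityI subsetI)
      fix z assume "z \<in> (`) (map_prod pr pr) ` carrier Loc"
      then show "z \<in> carrier QL.Loc"
        unfolding carrier_Loc using image_frac QL.frac_closed pr_closed by auto
    next
      fix z assume "z \<in> carrier QL.Loc"
      then obtain y w where z: "z = QL.frac y w" "y \<in> pr ` S" "w \<in> carrier Quo"
        unfolding QL.carrier_Loc by blast
      then obtain s r where "y = pr s" "s \<in> S" "w = pr r" "r \<in> carrier R" by (auto elim!: pr_surj)
      then show "z \<in> (`) (map_prod pr pr) ` carrier Loc"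
        using z(1) image_frac frac_closed by (intro image_eqI[of _ _ "frac s r"]) auto
    qed
  qed
  have "(`) (map_prod pr pr) \<in> ring_hom Loc QL.Loc"
  proof (rule ring_hom_memI)
    show "map_prod pr pr ` x \<in> carrier QL.Loc" if "x \<in> carrier Loc" for x
      using bij that by (auto simp: bij_betw_def)
    show "map_prod pr pr ` \<one>\<^bsub>Loc\<^esub> = \<one>\<^bsub>QL.Loc\<^esub>"
      unfolding one_Loc QL.one_Loc using image_frac by (simp add: pr_one)
    fix x y assume "x \<in> carrier Loc" "y \<in> carrier Loc"
    then obtain s r t q where x: "x = frac s r" "s \<in> S" "r \<in> carrier R"
      and y: "y = frac t q" "t \<in> S" "q \<in> carrier R" unfolding carrier_Loc by blast
    have cR: "s \<in> carrier R" "t \<in> carrier R" using x y by auto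
    have im: "map_prod pr pr ` x = QL.frac (pr s) (pr r)" "map_prod pr pr ` y = QL.frac (pr t) (pr q)"
      using image_frac x y by auto
    have im_c: "pr s \<in> pr ` S" "pr r \<in> carrier Quo" "pr t \<in> pr ` S" "pr q \<in> carrier Quo"
      using x y pr_closed by auto
    show "map_prod pr pr ` (x \<otimes>\<^bsub>Loc\<^esub> y) = map_prod pr pr ` x \<otimes>\<^bsub>QL.Loc\<^esub> map_prod pr pr ` y"
    proof -
      \<comment> \<open>The images of \<open>a\<close> and \<open>b\<close> are admissible auxiliary
        factors for the product in the quotient.\<close>
      from Den_l_Ore[OF Den x(3) y(2)] obtain a b
        where ab: "a \<in> S" "b \<in> carrier R" "a \<otimes> r = b \<otimes> t" .
      have "map_prod pr pr ` (x \<otimes>\<^bsub>Loc\<^esub> y) = QL.frac (pr (a \<otimes> s)) (pr (b \<otimes> q))"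
        unfolding x(1) y(1) frac_mult[OF x(2,3) y(2,3) ab]
        by (rule image_frac) (use ab x y in auto)
      also have "\<dots> = QL.frac (pr a \<otimes>\<^bsub>Quo\<^esub> pr s) (pr b \<otimes>\<^bsub>Quo\<^esub> pr q)"
        using ab(1,2) cR y by (simp add: pr_mult)
      also have "\<dots> = map_prod pr pr ` x \<otimes>\<^bsub>QL.Loc\<^esub> map_prod pr pr ` y"
        unfolding im
        by (rule QL.frac_mult[OF im_c, symmetric])
          (use ab x cR pr_closed in \<open>simp_all add: pr_mult[symmetric]\<close>)
      finally show ?thesis .
    qed
    show "map_prod pr pr ` (x \<oplus>\<^bsub>Loc\<^esub> y) = map_prod pr pr ` x \<oplus>\<^bsub>QL.Loc\<^esub> map_prod pr pr ` y"
    proof -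
      \<comment> \<open>For sums the Ore condition is applied to the two denominators; it yields
        \<open>a\<close> in \<open>S\<close>, so \<open>a \<otimes> s\<close> is a common
        denominator in \<open>S\<close>.\<close>
      from Den_l_Ore[OF Den cR(1) y(2)] obtain a b
        where ab: "a \<in> S" "b \<in> carrier R" "a \<otimes> s = b \<otimes> t" .
      have aR: "a \<in> carrier R" and as: "a \<otimes> s \<in> S" using ab(1) x by auto
      have "map_prod pr pr ` (x \<oplus>\<^bsub>Loc\<^esub> y) = QL.frac (pr (a \<otimes> s)) (pr (a \<otimes> r \<oplus> b \<otimes> q))"
        unfolding x(1) y(1) frac_add[OF x(2,3) y(2,3) aR ab(2,3) as]
        by (rule image_frac) (use as aR ab(2) x y in auto)
      also have "\<dots> = QL.frac (pr a \<otimes>\<^bsub>Quo\<^esub> pr s) (pr a \<otimes>\<^bsub>Quo\<^esub> pr r \<oplus>\<^bsub>Quo\<^esub> pr b \<otimes>\<^bsub>Quo\<^esub> pr q)"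
        using ab(2) aR cR x y by (simp add: pr_mult pr_add)
      also have "\<dots> = map_prod pr pr ` x \<oplus>\<^bsub>QL.Loc\<^esub> map_prod pr pr ` y"
        unfolding im
        by (rule QL.frac_add[OF im_c, symmetric])
          (use ab(2) as aR cR pr_closed in \<open>simp_all add: pr_mult[symmetric] ab(3)[symmetric]\<close>)
      finally show ?thesis .
    qed
  qed
  then show ?thesis using bij unfolding is_ring_iso_def ring_iso_def by blast
qed

end

section \<open>Specialization of the general results to \<open>T_l R\<close>\<close>

theorem theorem1p1:
  fixes R :: "('a, 'm) ring_scheme"
    and \<ll> :: "'a set"
    and \<pi> :: "'a \<Rightarrow> 'a set"
    and \<sigma> :: "'a \<Rightarrow> ('a \<times> 'a) set"
  assumes ring: "ring R" and nonzero: "\<one>\<^bsub>R\<^esub> \<noteq> \<zero>\<^bsub>R\<^esub>"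
    and l_eq: "\<ll> = strong_ideal R"
    and pi_eq: "\<pi> = (\<lambda>r. \<ll> +>\<^bsub>R\<^esub> r)"
    and sigma_eq: "\<sigma> = (\<lambda>r. left_frac R (T_l R) \<one>\<^bsub>R\<^esub> r)"
  shows "T_l R = S_l R \<ll>
    \<and> (strong_Q_l R = Q_la R \<ll> \<and> Q_la R \<ll> \<simeq> Q_l (R Quot \<ll>))
    \<and> T_l R = {r \<in> carrier R. \<sigma> r \<in> Units (strong_Q_l R)}
    \<and> T_l R = {r \<in> carrier R. \<pi> r \<in> S_l (R Quot \<ll>) {\<zero>\<^bsub>R Quot \<ll>\<^esub>}}
    \<and> Units (strong_Q_l R) = {left_frac R (T_l R) s t | s t. s \<in> T_l R \<and> t \<in> T_l R}"
proof -
  have l: "\<ll> = ass R (T_l R)" unfolding l_eq strong_ideal_def ..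
  have T: "T_l R = S_l R \<ll>" unfolding l_eq by (rule ring.T_l_eq_S_l[OF ring nonzero])
  \<comment> \<open>The first claim, with \<open>\<ll>\<close> read as \<open>ass R (T_l R)\<close>,
    is exactly the saturation hypothesis.\<close>
  interpret saturated_denominator_set R "T_l R"
    by (intro saturated_denominator_set.intro left_denominator_set.intro
        left_denominator_set_axioms.intro saturated_denominator_set_axioms.intro
        ring ring.T_l_Den_l[OF ring nonzero] T[unfolded l])
  \<comment> \<open>The first two rings both localize \<open>R\<close> at \<open>T_l R\<close>; the
    third localizes the quotient at the image of \<open>T_l R\<close>, which is its largest regular
    set.\<close>
  have Q: "strong_Q_l R = Loc" "Q_la R \<ll> = Loc" "Q_l (R Quot \<ll>) = QL.Loc"
    unfolding strong_Q_l_def Q_la_def Q_l_def T[symmetric]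
    by (simp_all add: l S_l_Quo_eq_image)
  show ?thesis
  proof (intro conjI)
    show "T_l R = {r \<in> carrier R. \<sigma> r \<in> Units (strong_Q_l R)}"
      unfolding Q sigma_eq using unit_numerators_eq unfolding unit_numerators_def by (rule sym)
    show "T_l R = {r \<in> carrier R. \<pi> r \<in> S_l (R Quot \<ll>) {\<zero>\<^bsub>R Quot \<ll>\<^esub>}}"
      unfolding pi_eq l by (rule vimage_S_l_Quo[symmetric])
    show "Units (strong_Q_l R) = {left_frac R (T_l R) s t | s t. s \<in> T_l R \<and> t \<in> T_l R}"
      unfolding Q by (rule Units_Loc_saturated[OF unit_numerators_eq])
    show "Q_la R \<ll> \<simeq> Q_l (R Quot \<ll>)" unfolding Q by (rule Loc_iso_Quo)
  qed (simp_all add: Q T[symmetric])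
qed

end
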